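(* Let $N>1$ be an odd integer, let $\xi,\eta,\zeta$ be positive parameters with $\xi>\zeta$ (and $\xi\notin\mathbb{Z}$, so that the eigenvalues $\lambda_n$ in the context are pairwise distinct), and put $$r_1=\frac{1-\zeta-\eta}{2},\quad r_2=\frac{\eta+\zeta+N}{2},\quad \rho_1=\frac{\eta-\zeta}{2},\quad \rho_2=\frac{\zeta-\eta-2\xi-N+1}{2},$$ so that $r_1+r_2=(N+1)/2$. Let $P_n$ be the monic Bannai-Ito polynomials with these parameters, with recurrence relation $P_{n+1}+b_nP_n+u_nP_{n-1}=xP_n$. Then $$u_n=\frac{n(-n+N-1+2\xi)(-n+N+1)(-n+2N+2\xi)}{16(-n+N+\xi)^2}\quad(n\text{ even}),$$ $$u_n=\frac{(n+2\eta-1)(-n+2\zeta+N)(-n-2\zeta+N+2\xi)(-n+2\eta+2N-1+2\xi)}{16(-n+N+\xi)^2}\quad(n\text{ odd}),$$ so $u_n>0$ for $n=1,\dots,N$ and $u_{N+1}=0$. The roots of $P_{N+1}$ are the distinct points $$x_s=-\tfrac14+(-1)^s\left(-\tfrac14+r_1-\tfrac s2\right),\qquad s=0,1,\dots,N,$$ and the polynomials satisfy $$\sum_{s=0}^Nw_sP_n(x_s)P_m(x_s)=\kappa_n^2\,\delta_{nm},\qquad n,m=0,1,\dots,N,$$ with some normalization constants $\kappa_n$ and positive weights $w_s=\varphi(x_s)>0$, where the symmetry factor $\varphi$ can be taken in the form $$\varphi(x)=\sigma_2(x)\,\frac{\Gamma(\rho_1-x)\,\Gamma(\rho_1+1+x)\,\Gamma(\rho_2-x)\,\Gamma(1+\rho_2+x)}{\Gamma(r_2+\frac12+x)\,\Gamma(r_2+\frac12-x)\,\Gamma(r_1+\frac12+x)\,\Gamma(r_1+\frac12-x)}$$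 with $\sigma_2$ odd and 1-periodic, so that on the grid $\sigma_2(x_s)=(-1)^s\,\mathrm{const}$ (the constant being chosen so that the weights are positive).
   Context: For real parameters $r_1,r_2,\rho_1,\rho_2$ the Dunkl shift operator $L$ acts by $$Lf(x)=F(x)(f(x)-f(-x))+G(x)(f(-x-1)-f(x)),\quad F(x)=\frac{(x-\rho_1)(x-\rho_2)}{2x},\quad G(x)=\frac{(x-r_1+1/2)(x-r_2+1/2)}{2x+1}.$$ It maps polynomials to polynomials and $Lx^n=\lambda_nx^n+O(x^{n-1})$ with $\lambda_n=n/2$ for even $n$ and $\lambda_n=r_1+r_2-\rho_1-\rho_2-(n+1)/2$ for odd $n$ (here $r_1+r_2-\rho_1-\rho_2=\xi+N$). When the $\lambda_n$ are pairwise distinct, the monic Bannai-Ito polynomial $P_n$ is the unique monic polynomial of degree $n$ with $LP_n=\lambda_nP_n$. For general parameters, with $g=\rho_1+\rho_2-r_1-r_2$, the recurrence coefficients are $$u_n=-\frac{n(n+2\rho_1+2\rho_2)(n-2r_1-2r_2)(n+2g)}{16(n+g)^2}\ (n\text{ even}),$$ $$u_n=-\frac{(n+2\rho_1-2r_1)(n+2\rho_1-2r_2)(n+2\rho_2-2r_1)(n+2\rho_2-2r_2)}{16(n+g)^2}\ (n\text{ odd}).$$ A symmetry factor is a function $\varphi$ for which $\varphi L$ is formally self-adjoint, i.e. $\varphi(-x)F(-x)=\varphi(x)F(x)$ and $\varphi(-x-1)G(-x-1)=\varphi(x)G(x)$; the Gamma-function expression for it is constructed for generic values of the parameters $r_1,r_2,\rho_1,\rho_2$.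 *)

theory Defs
  imports
    "HOL-Analysis.Analysis"
    "HOL-Computational_Algebra.Polynomial"
begin

definition dunkl_F :: "real \<Rightarrow> real \<Rightarrow> real \<Rightarrow> real" where
  "dunkl_F \<rho>1 \<rho>2 x = (x - \<rho>1) * (x - \<rho>2) / (2 * x)"

definition dunkl_G :: "real \<Rightarrow> real \<Rightarrow> real \<Rightarrow> real" where
  "dunkl_G r1 r2 x = (x - r1 + 1/2) * (x - r2 + 1/2) / (2 * x + 1)"

definition dunkl_shift ::
  "real \<Rightarrow> real \<Rightarrow> real \<Rightarrow> real \<Rightarrow> (real \<Rightarrow> real) \<Rightarrow> real \<Rightarrow> real" where
  "dunkl_shift r1 r2 \<rho>1 \<rho>2 f x =
     dunkl_F \<rho>1 \<rho>2 x * (f x - f (- x)) + dunkl_G r1 r2 x * (f (- x - 1) - f x)"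

definition bi_eigenvalue :: "real \<Rightarrow> real \<Rightarrow> real \<Rightarrow> real \<Rightarrow> nat \<Rightarrow> real" where
  "bi_eigenvalue r1 r2 \<rho>1 \<rho>2 n =
     (if even n then real n / 2 else r1 + r2 - \<rho>1 - \<rho>2 - (real n + 1) / 2)"

text \<open>
  The operator maps polynomials to polynomials after cancelling the denominators \<open>2x\<close> and
  \<open>2x + 1\<close>.  Two polynomials agreeing off \<open>{0, -1/2}\<close> are equal, so the eigenvalue equation
  for the resulting polynomials is imposed off these two removable singularities, where
  division by zero would give a wrong value.
\<close>

definition bi_eigenpoly ::
  "real \<Rightarrow> real \<Rightarrow> real \<Rightarrow> real \<Rightarrow> nat \<Rightarrow> real poly \<Rightarrow> bool" where
  "bi_eigenpoly r1 r2 \<rho>1 \<rho>2 n p \<longleftrightarrow>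
     (\<forall>x. x \<noteq> 0 \<longrightarrow> x \<noteq> - 1/2 \<longrightarrow>
        dunkl_shift r1 r2 \<rho>1 \<rho>2 (poly p) x = bi_eigenvalue r1 r2 \<rho>1 \<rho>2 n * poly p x)"

text \<open>Meaningful when the eigenvalues are pairwise distinct.\<close>

definition bannai_ito :: "real \<Rightarrow> real \<Rightarrow> real \<Rightarrow> real \<Rightarrow> nat \<Rightarrow> real poly" where
  "bannai_ito r1 r2 \<rho>1 \<rho>2 n =
     (THE p. degree p = n \<and> lead_coeff p = 1 \<and> bi_eigenpoly r1 r2 \<rho>1 \<rho>2 n p)"

definition bi_grid :: "real \<Rightarrow> nat \<Rightarrow> real" where
  "bi_grid r1 s = - 1/4 + (- 1) ^ s * (- 1/4 + r1 - real s / 2)"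

text \<open>
  The domain \<open>D\<close> is the set where \<open>\<phi>\<close> has no pole.  At \<open>x = 0\<close> and \<open>x = -1/2\<close>, where \<open>F\<close> and
  \<open>G\<close> may be singular, the respective relation relates a point to itself and is trivial.
\<close>

definition symmetry_factor_on ::
  "real set \<Rightarrow> real \<Rightarrow> real \<Rightarrow> real \<Rightarrow> real \<Rightarrow> (real \<Rightarrow> real) \<Rightarrow> bool" where
  "symmetry_factor_on D r1 r2 \<rho>1 \<rho>2 \<phi> \<longleftrightarrow>
     (\<forall>x. x \<in> D \<longrightarrow> - x \<in> D \<longrightarrow>
        \<phi> (- x) * dunkl_F \<rho>1 \<rho>2 (- x) = \<phi> x * dunkl_F \<rho>1 \<rho>2 x) \<and>
     (\<forall>x. x \<in> D \<longrightarrow> - x - 1 \<in> D \<longrightarrow>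
        \<phi> (- x - 1) * dunkl_G r1 r2 (- x - 1) = \<phi> x * dunkl_G r1 r2 x)"

definition odd_one_periodic :: "(real \<Rightarrow> real) \<Rightarrow> bool" where
  "odd_one_periodic \<sigma> \<longleftrightarrow> (\<forall>x. \<sigma> (- x) = - \<sigma> x) \<and> (\<forall>x. \<sigma> (x + 1) = \<sigma> x)"

definition gamma_factor ::
  "(real \<Rightarrow> real) \<Rightarrow> real \<Rightarrow> real \<Rightarrow> real \<Rightarrow> real \<Rightarrow> real \<Rightarrow> real" where
  "gamma_factor \<sigma> r1 r2 \<rho>1 \<rho>2 x =
     \<sigma> x * (Gamma (\<rho>1 - x) * Gamma (\<rho>1 + 1 + x) * Gamma (\<rho>2 - x) * Gamma (1 + \<rho>2 + x)) /
     (Gamma (r2 + 1/2 + x) * Gamma (r2 + 1/2 - x) * Gamma (r1 + 1/2 + x) * Gamma (r1 + 1/2 - x))"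

text \<open>
  A pole of a Gamma function in the denominator of \<open>gamma_factor\<close> is a zero of the quotient;
  the conventions \<open>Gamma (-n) = 0\<close> and \<open>x / 0 = 0\<close> give the correct value there.  Only the
  numerator is a source of poles.
\<close>

definition gamma_factor_domain :: "real \<Rightarrow> real \<Rightarrow> real set" where
  "gamma_factor_domain \<rho>1 \<rho>2 =
     {x. {\<rho>1 - x, \<rho>1 + 1 + x, \<rho>2 - x, 1 + \<rho>2 + x} \<inter> \<int>\<^sub>\<le>\<^sub>0 = {}}"

text \<open>Genericity of the parameters: no Gamma function in \<open>gamma_factor\<close> has a pole on the grid.\<close>

definition gamma_generic :: "nat \<Rightarrow> real \<Rightarrow> real \<Rightarrow> real \<Rightarrow> real \<Rightarrow> bool" where
  "gamma_generic N r1 r2 \<rho>1 \<rho>2 \<longleftrightarrow>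
     (\<forall>s\<le>N. let x = bi_grid r1 s in
        {\<rho>1 - x, \<rho>1 + 1 + x, \<rho>2 - x, 1 + \<rho>2 + x,
         r2 + 1/2 + x, r2 + 1/2 - x, r1 + 1/2 + x, r1 + 1/2 - x} \<inter> \<int>\<^sub>\<le>\<^sub>0 = {})"

end

theory Submission
  imports Defs
begin

text \<open>
  The grid \<open>x\<^sub>0, x\<^sub>1, \<dots>\<close> is the orbit of \<open>x\<^sub>0 = r1 - 1/2\<close> under the two reflections
  \<open>x \<mapsto> -x\<close> and \<open>x \<mapsto> -x - 1\<close> that occur in \<open>L\<close>, and \<open>x\<^sub>0\<close> is a zero of \<open>G\<close>.  Everything is read
  off from the Newton basis \<open>nu k = (x - x\<^sub>0) \<dots> (x - x\<^bsub>k-1\<^esub>)\<close>.  At \<open>x\<^sub>j\<close> the operator sees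
  only \<open>x\<^bsub>j-1\<^esub>, x\<^sub>j, x\<^bsub>j+1\<^esub>\<close>, so \<open>L (nu k) = lam k nu k + tau k nu (k - 1)\<close> with explicit
  \<open>tau\<close> (\<open>L_newton\<close>).  Distinct eigenvalues then give a unique monic eigenvector in each
  degree, with explicit Newton coefficients (\<open>P_eigen\<close>, \<open>bannai_ito_eq_P\<close>).  The condition
  \<open>r1 + r2 = (N + 1)/2\<close> says \<open>tau (N + 1) = 0\<close>, hence \<open>P (N + 1) = nu (N + 1)\<close>, whose roots are
  the grid points.

  The recurrence comes from a relation of the Bannai-Ito algebra.  After an affine
  rescaling, \<open>L\<close> and multiplication by \<open>x\<close> become \<open>K\<close> and \<open>Y\<close>, and with
  \<open>J = K Y + Y K\<close> one has \<open>K J + J K = Y + a K + b\<close>; in the Newton basis this is an identity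
  between a few scalars (\<open>anticommutator_K_J\<close>).  Applied to \<open>P n\<close>, it confines \<open>x P n\<close> to the
  span of \<open>P (n + 1)\<close>, \<open>P n\<close>, \<open>P (n - 1)\<close> (\<open>P_recurrence\<close>), and the top three Newton
  coefficients determine \<open>u n\<close> (\<open>rec_u_eq\<close>).

  For orthogonality, a symmetry factor that is supported on finitely many points makes \<open>L\<close>
  self-adjoint for the corresponding weighted sum (\<open>dunkl_shift_self_adjoint\<close>), so
  eigenvectors for different eigenvalues are orthogonal.  Along the orbit the defining
  relations fix the quotient of consecutive weights.  The sign conditions on the parameters
  make \<open>F > 0\<close> at all \<open>x\<^sub>s\<close> with \<open>s \<le> N\<close> and \<open>G < 0\<close> at the inner ones, so these quotients are
  positive, and \<open>G\<close> vanishes at \<open>x\<^sub>0\<close> and \<open>x\<^sub>N\<close>, so the chain may be cut there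
  (\<open>grid_phi_symmetry\<close>).  By the same uniqueness, any symmetry factor without poles on the grid,
  such as the one built from Gamma functions for generic parameters, agrees with these
  weights up to a constant (\<open>symmetry_factor_eq_weight\<close>).
\<close>

section \<open>Polynomials of small degree and the Newton basis\<close>

lemma poly_eqI_off_finite:
  fixes p q :: "real poly"
  assumes "finite S" and "\<And>x. x \<notin> S \<Longrightarrow> poly p x = poly q x"
  shows "p = q"
proof (rule ccontr)
  assume "p \<noteq> q"
  then have "finite {x. poly (p - q) x = 0}"
    by (intro poly_roots_finite) simp
  moreover have "UNIV - S \<subseteq> {x. poly (p - q) x = 0}"
    using assms(2) by auto
  ultimately have "finite (UNIV - S)"
    by (rule finite_subset[rotated])
  then show False
    using \<open>finite S\<close> infinite_UNIV_char_0[where 'a = real] by auto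
qed

lemma linear_factor_mult_div:
  fixes p :: "real poly"
  assumes "poly p a = 0"
  shows "smult c [:- a, 1:] * (p div smult c [:- a, 1:]) = (if c = 0 then 0 else p)"
proof (cases "c = 0")
  case False
  have "[:- a, 1:] dvd p"
    using assms by (simp add: poly_eq_0_iff_dvd)
  then have "smult c [:- a, 1:] dvd p"
    using False by (simp only: smult_dvd_iff) simp
  then show ?thesis
    using False by (simp only: dvd_mult_div_cancel) simp
qed simp

text \<open>
  The strict bound \<open>degree p < d\<close>, except that it includes the zero polynomial and still means
  something at \<open>d = 0\<close>.
\<close>

definition deg_below :: "nat \<Rightarrow> real poly \<Rightarrow> bool" where
  "deg_below d p \<longleftrightarrow> (\<forall>k\<ge>d. coeff p k = 0)"

lemma deg_below_zero [simp]: "deg_below d 0"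
  by (simp add: deg_below_def)

lemma deg_below_add: "deg_below d p \<Longrightarrow> deg_below d q \<Longrightarrow> deg_below d (p + q)"
  by (simp add: deg_below_def)

lemma deg_below_diff: "deg_below d p \<Longrightarrow> deg_below d q \<Longrightarrow> deg_below d (p - q)"
  by (simp add: deg_below_def)

lemma deg_below_smult: "deg_below d p \<Longrightarrow> deg_below d (smult c p)"
  by (simp add: deg_below_def)

lemma deg_below_sum: "(\<And>i. i \<in> A \<Longrightarrow> deg_below d (f i)) \<Longrightarrow> deg_below d (sum f A)"
  by (simp add: deg_below_def coeff_sum)

lemma deg_below_mono: "deg_below d p \<Longrightarrow> d \<le> e \<Longrightarrow> deg_below e p"
  by (simp add: deg_below_def)

lemma deg_below_iff: "deg_below d p \<longleftrightarrow> p = 0 \<or> degree p < d"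
proof
  assume "deg_below d p"
  then show "p = 0 \<or> degree p < d"
    unfolding deg_below_def using leading_coeff_0_iff[of p] by (auto simp: not_less[symmetric])
next
  assume "p = 0 \<or> degree p < d"
  then show "deg_below d p"
    by (auto simp: deg_below_def intro: coeff_eq_0)
qed

lemma deg_below_mult_X: "deg_below d p \<Longrightarrow> deg_below (Suc d) ([:0, 1:] * p)"
  by (auto simp: deg_below_def coeff_pCons split: nat.splits)

lemma smult_sum_right: "smult c (sum f A) = (\<Sum>i\<in>A. smult c (f i))"
  by (induction A rule: infinite_finite_induct) (simp_all add: smult_add_right)

definition newton :: "real \<Rightarrow> nat \<Rightarrow> real poly" where
  "newton r k = (\<Prod>j<k. [:- bi_grid r j, 1:])"

lemma newton_0 [simp]: "newton r 0 = 1"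
  by (simp add: newton_def)

lemma newton_Suc: "newton r (Suc k) = newton r k * [:- bi_grid r k, 1:]"
  by (simp add: newton_def)

lemma poly_newton_Suc: "poly (newton r (Suc k)) y = poly (newton r k) y * (y - bi_grid r k)"
  by (simp add: newton_Suc algebra_simps)

lemma poly_newton_eq_0_iff: "poly (newton r k) t = 0 \<longleftrightarrow> (\<exists>j<k. t = bi_grid r j)"
  by (auto simp: newton_def poly_prod)

lemma newton_mult_X: "[:0, 1:] * newton r k = newton r (Suc k) + smult (bi_grid r k) (newton r k)"
  by (simp add: newton_Suc algebra_simps)

lemma degree_newton [simp]: "degree (newton r k) = k"
  by (simp add: newton_def degree_prod_eq_sum_degree)

lemma coeff_newton_self [simp]: "coeff (newton r k) k = 1"
proof -
  have "lead_coeff (newton r k) = 1"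
    by (simp add: newton_def lead_coeff_prod)
  then show ?thesis by simp
qed

lemma deg_below_newton: "k < d \<Longrightarrow> deg_below d (newton r k)"
  by (simp add: deg_below_iff)

lemma newton_induct [consumes 1, case_names lincomb zero newton]:
  assumes "deg_below d p"
    and "\<And>p q c. Q p \<Longrightarrow> Q q \<Longrightarrow> Q (smult c p + q)"
    and "Q 0" and "\<And>k. k < d \<Longrightarrow> Q (newton r k)"
  shows "Q p"
  using assms(1,4)
proof (induction d arbitrary: p)
  case 0
  then have "p = 0" by (simp add: deg_below_iff)
  then show ?case using assms(3) by simp
next
  case (Suc d)
  define q where "q = p - smult (coeff p d) (newton r d)"
  have "deg_below d q"
    unfolding deg_below_def
  proof (intro allI impI)
    fix k assume "d \<le> k"
    show "coeff q k = 0"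
    proof (cases "k = d")
      case False
      with \<open>d \<le> k\<close> Suc.prems(1) show ?thesis
        by (simp add: q_def deg_below_def coeff_eq_0)
    qed (simp add: q_def)
  qed
  then have "Q q"
    by (rule Suc.IH) (simp add: Suc.prems(2))
  then have "Q (smult (coeff p d) (newton r d) + q)"
    by (intro assms(2)[OF Suc.prems(2)]) simp_all
  then show ?case by (simp add: q_def)
qed

lemma grid_0: "bi_grid r 0 = r - 1/2"
  by (simp add: bi_grid_def)

lemma grid_even: "bi_grid r (2 * m) = r - 1/2 - real m"
  and grid_odd: "bi_grid r (Suc (2 * m)) = 1/2 - r + real m"
  and grid_Suc_odd: "bi_grid r (Suc (Suc (2 * m))) = r - 3/2 - real m"
  by (simp_all add: bi_grid_def field_simps)

text \<open>
  The grid is one orbit of the two reflections \<open>x \<mapsto> -x\<close> and \<open>x \<mapsto> -x - 1\<close>, which pair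
  \<open>x\<^sub>0, x\<^sub>1 | x\<^sub>2, x\<^sub>3 | \<dots>\<close> and \<open>x\<^sub>1, x\<^sub>2 | x\<^sub>3, x\<^sub>4 | \<dots>\<close> respectively.  The next two lemmas say
  what these pairings do to the Newton polynomials; in the second one the factor \<open>x - x\<^sub>0\<close>
  has no partner and appears on both sides instead of being divided out.
\<close>

lemma newton_even_reflect: "poly (newton r (2 * m)) (- x) = poly (newton r (2 * m)) x"
proof (induction m)
  case (Suc m)
  have "poly (newton r (2 * Suc m)) y
      = poly (newton r (2 * m)) y * ((r - 1/2 - real m)^2 - y^2) * - 1" for y
    by (simp only: mult_Suc_right add_2_eq_Suc poly_newton_Suc grid_even grid_odd)
       algebra
  then show ?case by (simp add: Suc)
qed simp

lemma newton_odd_reflect: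
  "(x - bi_grid r 0) * poly (newton r (Suc (2 * m))) (- x - 1)
     = (- x - 1 - bi_grid r 0) * poly (newton r (Suc (2 * m))) x"
proof (induction m)
  case (Suc m)
  let ?p = "newton r (Suc (2 * m))"
  have step: "poly (newton r (Suc (2 * Suc m))) y
      = poly ?p y * ((y - (1/2 - r + real m)) * (y - (r - 3/2 - real m)))" for y
    by (simp add: poly_newton_Suc[of _ "Suc _"] grid_Suc_odd grid_odd mult.assoc)
  have swap: "(- x - 1 - (1/2 - r + real m)) * (- x - 1 - (r - 3/2 - real m))
      = (x - (1/2 - r + real m)) * (x - (r - 3/2 - real m))"
    by (simp add: field_simps)
  have "(x - bi_grid r 0) * poly (newton r (Suc (2 * Suc m))) (- x - 1)
      = ((x - bi_grid r 0) * poly ?p (- x - 1))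
          * ((x - (1/2 - r + real m)) * (x - (r - 3/2 - real m)))"
    unfolding step swap by (simp only: mult.assoc)
  then show ?case
    unfolding Suc.IH step by (simp only: mult.assoc)
qed (simp add: newton_Suc)

section \<open>The operator on polynomials\<close>

locale dunkl =
  fixes r1 r2 \<rho>1 \<rho>2 :: real
begin

abbreviation "node \<equiv> bi_grid r1"
abbreviation "nu \<equiv> newton r1"
abbreviation "lam \<equiv> bi_eigenvalue r1 r2 \<rho>1 \<rho>2"
abbreviation "F \<equiv> dunkl_F \<rho>1 \<rho>2"
abbreviation "G \<equiv> dunkl_G r1 r2"

text \<open>
  Both divisions are exact, because the numerators vanish at the fixed points \<open>0\<close> and \<open>-1/2\<close>
  of the two reflections; the divisors are written as \<open>2 (x - a)\<close> to display these roots.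
\<close>

definition L :: "real poly \<Rightarrow> real poly" where
  "L p = [:- \<rho>1, 1:] * [:- \<rho>2, 1:] * ((p - pcompose p [:0, -1:]) div smult 2 [:- 0, 1:])
       + [:1/2 - r1, 1:] * [:1/2 - r2, 1:]
           * ((pcompose p [:-1, -1:] - p) div smult 2 [:- (- 1/2), 1:])"

lemma poly_L_quotients:
  obtains q1 q2 where
    "\<And>x. 2 * x * poly q1 x = poly p x - poly p (- x)"
    "\<And>x. (2 * x + 1) * poly q2 x = poly p (- x - 1) - poly p x"
    "\<And>x. poly (L p) x = (x - \<rho>1) * (x - \<rho>2) * poly q1 x
        + (x - r1 + 1/2) * (x - r2 + 1/2) * poly q2 x"
proof
  define q1 where "q1 = (p - pcompose p [:0, -1:]) div smult 2 [:- 0, 1:]"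
  define q2 where "q2 = (pcompose p [:-1, -1:] - p) div smult 2 [:- (- 1/2), 1:]"
  have q1: "smult 2 [:- 0, 1:] * q1 = p - pcompose p [:0, -1:]"
    unfolding q1_def by (subst linear_factor_mult_div) (simp_all add: poly_pcompose)
  have q2: "smult 2 [:- (- 1/2), 1:] * q2 = pcompose p [:-1, -1:] - p"
    unfolding q2_def by (subst linear_factor_mult_div) (simp_all add: poly_pcompose)
  show "2 * x * poly q1 x = poly p x - poly p (- x)" for x
    using arg_cong[OF q1, of "\<lambda>q. poly q x"] by (simp add: poly_pcompose)
  show "(2 * x + 1) * poly q2 x = poly p (- x - 1) - poly p x" for x
    using arg_cong[OF q2, of "\<lambda>q. poly q x"] by (simp add: poly_pcompose algebra_simps minus_diff_commute)
  show "poly (L p) x = (x - \<rho>1) * (x - \<rho>2) * poly q1 x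
        + (x - r1 + 1/2) * (x - r2 + 1/2) * poly q2 x" for x
    unfolding L_def q1_def[symmetric] q2_def[symmetric] by (simp add: algebra_simps)
qed

lemma poly_L:
  assumes "x \<noteq> 0" "x \<noteq> - 1/2"
  shows "poly (L p) x = dunkl_shift r1 r2 \<rho>1 \<rho>2 (poly p) x"
proof -
  obtain q1 q2 where
    q: "2 * x * poly q1 x = poly p x - poly p (- x)"
    "(2 * x + 1) * poly q2 x = poly p (- x - 1) - poly p x"
    and L: "poly (L p) x = (x - \<rho>1) * (x - \<rho>2) * poly q1 x
        + (x - r1 + 1/2) * (x - r2 + 1/2) * poly q2 x"
    using poly_L_quotients by metis
  have "2 * x + 1 \<noteq> 0"
    using assms by simp
  then show ?thesis
    using assms unfolding L dunkl_shift_def dunkl_F_def dunkl_G_def q[symmetric]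
    by simp
qed

text \<open>
  At \<open>x = -1/2\<close> the value of \<open>L p\<close> is a limit that is not visible in \<open>dunkl_shift\<close>.  For
  \<open>r1 < 1/2\<close> the grid can meet this point only at \<open>x\<^sub>0\<close>, where a numerator factor of \<open>G\<close>
  vanishes and restores the pointwise formula.
\<close>

lemma poly_L_first_node:
  assumes "node 0 \<noteq> 0"
  shows "poly (L p) (node 0) = F (node 0) * (poly p (node 0) - poly p (- node 0))"
proof -
  obtain q1 q2 where
    q: "2 * node 0 * poly q1 (node 0) = poly p (node 0) - poly p (- node 0)"
    and L: "poly (L p) (node 0) = (node 0 - \<rho>1) * (node 0 - \<rho>2) * poly q1 (node 0)
        + (node 0 - r1 + 1/2) * (node 0 - r2 + 1/2) * poly q2 (node 0)"
    using poly_L_quotients by metis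
  have "node 0 - r1 + 1/2 = 0"
    by (simp add: grid_0)
  then show ?thesis
    using assms unfolding L dunkl_F_def q[symmetric] by simp
qed

lemma L_eqI:
  assumes "\<And>x. x \<noteq> 0 \<Longrightarrow> x \<noteq> - 1/2 \<Longrightarrow> dunkl_shift r1 r2 \<rho>1 \<rho>2 (poly p) x = poly q x"
  shows "L p = q"
  by (rule poly_eqI_off_finite[of "{0, - 1/2}"]) (auto simp: poly_L assms)

lemma eigenpoly_iff: "bi_eigenpoly r1 r2 \<rho>1 \<rho>2 n p \<longleftrightarrow> L p = smult (lam n) p"
proof
  assume "bi_eigenpoly r1 r2 \<rho>1 \<rho>2 n p"
  then show "L p = smult (lam n) p"
    by (intro L_eqI) (simp add: bi_eigenpoly_def)
next
  assume "L p = smult (lam n) p"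
  then show "bi_eigenpoly r1 r2 \<rho>1 \<rho>2 n p"
    by (auto simp: bi_eigenpoly_def poly_L[symmetric])
qed

lemma L_lincomb: "L (smult c p + q) = smult c (L p) + L q"
  by (rule L_eqI) (simp add: poly_L dunkl_shift_def algebra_simps)

lemma L_0 [simp]: "L 0 = 0"
  by (simp add: L_def)

lemma L_add: "L (p + q) = L p + L q"
  using L_lincomb[of 1 p q] by simp

lemma L_smult: "L (smult c p) = smult c (L p)"
  using L_lincomb[of c p 0] by simp

lemma L_sum: "L (sum f A) = (\<Sum>i\<in>A. L (f i))"
  by (induction A rule: infinite_finite_induct) (simp_all add: L_add)

definition tau :: "nat \<Rightarrow> real" where
  "tau k = (if even k then real k / 2 * (real k / 2 - r1 - r2)
            else (r1 - real k / 2 - \<rho>1) * (r1 - real k / 2 - \<rho>2))"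

lemma tau_0 [simp]: "tau 0 = 0"
  by (simp add: tau_def)

lemma G_mult_eqI:
  assumes "x \<noteq> - 1/2" and "(x - r1 + 1/2) * d = (2 * x + 1) * e"
  shows "G x * d = (x - r2 + 1/2) * e"
proof -
  have "G x * d = (x - r2 + 1/2) * ((x - r1 + 1/2) * d) / (2 * x + 1)"
    by (simp add: dunkl_G_def)
  then show ?thesis
    using assms(1) unfolding assms(2) by simp
qed

text \<open>
  \<open>F\<close> multiplies a difference that vanishes on even polynomials, and \<open>G\<close> one that is explicit
  by the second reflection lemma, because \<open>x - x\<^sub>0\<close> is a numerator factor of \<open>G\<close>.  So \<open>L\<close> is
  bidiagonal in the Newton basis.
\<close>

lemma L_newton: "L (nu k) = smult (lam k) (nu k) + smult (tau k) (nu (k - 1))"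
proof (cases "even k")
  case True
  then obtain m where k: "k = 2 * m" by (elim evenE)
  show ?thesis
  proof (cases m)
    case 0
    then show ?thesis
      by (intro L_eqI) (simp add: k dunkl_shift_def bi_eigenvalue_def)
  next
    case (Suc l)
    let ?p = "nu (Suc (2 * l))"
    have nu_k: "poly (nu k) y = poly ?p y * (y - (1/2 - r1 + real l))" for y
      by (simp add: k Suc poly_newton_Suc[of _ "Suc _"] grid_odd)
    show ?thesis
    proof (rule L_eqI)
      fix x :: real assume x: "x \<noteq> 0" "x \<noteq> - 1/2"
      have *: "(x - r1 + 1/2) * poly ?p (- x - 1) = (- x - 1/2 - r1) * poly ?p x"
        using newton_odd_reflect[of x r1 l] unfolding grid_0 by (simp add: algebra_simps)
      have m: "real m = real l + 1"
        by (simp add: Suc)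
      have "(x - r1 + 1/2) * (poly (nu k) (- x - 1) - poly (nu k) x)
          = (2 * x + 1) * (poly ?p x * real m)"
        using * unfolding nu_k m by algebra
      then have "G x * (poly (nu k) (- x - 1) - poly (nu k) x)
          = (x - r2 + 1/2) * (poly ?p x * real m)"
        by (rule G_mult_eqI[OF x(2)])
      moreover have "poly (nu k) (- x) = poly (nu k) x"
        unfolding k by (rule newton_even_reflect)
      ultimately have "dunkl_shift r1 r2 \<rho>1 \<rho>2 (poly (nu k)) x
          = (x - r2 + 1/2) * (poly ?p x * real m)"
        by (simp add: dunkl_shift_def)
      also have "\<dots> = real m * poly (nu k) x + real m * (real m - r1 - r2) * poly ?p x"
        unfolding nu_k m by algebra
      also have "\<dots> = poly (smult (lam k) (nu k) + smult (tau k) (nu (k - 1))) x"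
      proof -
        have "lam k = real m" and "tau k = real m * (real m - r1 - r2)"
          by (simp_all add: k bi_eigenvalue_def tau_def)
        then show ?thesis
          by (simp add: k Suc)
      qed
      finally show "dunkl_shift r1 r2 \<rho>1 \<rho>2 (poly (nu k)) x = \<dots>" .
    qed
  qed
next
  case False
  then obtain m where "k = 2 * m + 1" by (elim oddE)
  then have k: "k = Suc (2 * m)" by simp
  let ?p = "nu (2 * m)"
  have nu_k: "poly (nu k) y = poly ?p y * (y - (r1 - 1/2 - real m))" for y
    by (simp add: k poly_newton_Suc grid_even)
  show ?thesis
  proof (rule L_eqI)
    fix x :: real assume x: "x \<noteq> 0" "x \<noteq> - 1/2"
    have *: "(x - r1 + 1/2) * poly (nu k) (- x - 1) = (- x - 1/2 - r1) * poly (nu k) x"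
      using newton_odd_reflect[of x r1 m] unfolding grid_0 k by (simp add: algebra_simps)
    have "(x - r1 + 1/2) * (poly (nu k) (- x - 1) - poly (nu k) x)
        = (2 * x + 1) * - poly (nu k) x"
      using * by algebra
    then have "G x * (poly (nu k) (- x - 1) - poly (nu k) x) = (x - r2 + 1/2) * - poly (nu k) x"
      by (rule G_mult_eqI[OF x(2)])
    moreover have "poly (nu k) x - poly (nu k) (- x) = 2 * x * poly ?p x"
      unfolding nu_k newton_even_reflect by algebra
    then have "F x * (poly (nu k) x - poly (nu k) (- x)) = (x - \<rho>1) * (x - \<rho>2) * poly ?p x"
      using x unfolding dunkl_F_def by simp
    ultimately have "dunkl_shift r1 r2 \<rho>1 \<rho>2 (poly (nu k)) x
        = (x - \<rho>1) * (x - \<rho>2) * poly ?p x - (x - r2 + 1/2) * poly (nu k) x"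
      by (simp add: dunkl_shift_def)
    also have "\<dots> = poly (smult (lam k) (nu k) + smult (tau k) (nu (k - 1))) x"
    proof -
      have lam_k: "lam k = (r1 - 1/2 - real m) + r2 - 1/2 - \<rho>1 - \<rho>2"
        and tau_k: "tau k = (r1 - 1/2 - real m - \<rho>1) * (r1 - 1/2 - real m - \<rho>2)"
        by (simp_all add: k bi_eigenvalue_def tau_def add_divide_distrib algebra_simps)
      have pred: "k - 1 = 2 * m"
        by (simp add: k)
      show ?thesis
        unfolding poly_add poly_smult nu_k lam_k tau_k pred by algebra
    qed
    finally show "dunkl_shift r1 r2 \<rho>1 \<rho>2 (poly (nu k)) x = \<dots>" .
  qed
qed

lemma L_triangular:
  assumes "deg_below (Suc n) p"
  shows "deg_below (Suc n) (L p) \<and> coeff (L p) n = lam n * coeff p n"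
  using assms
proof (induction p rule: newton_induct[where r = r1])
  case (newton k)
  have "deg_below (Suc n) (L (nu k))"
    unfolding L_newton using newton
    by (intro deg_below_add deg_below_smult deg_below_newton) auto
  moreover have "coeff (L (nu k)) n = lam n * coeff (nu k) n"
  proof (cases "k = 0")
    case True
    then show ?thesis
      using L_newton[of 0] by (cases "n = 0") (simp_all add: coeff_eq_0)
  next
    case False
    then have "coeff (nu (k - 1)) n = 0"
      using newton by (intro coeff_eq_0) simp
    then show ?thesis
      using newton by (cases "k = n") (simp_all add: L_newton coeff_eq_0)
  qed
  ultimately show ?case by simp
next
  case (lincomb p q c)
  then show ?case
    by (auto simp: L_lincomb distrib_left intro: deg_below_add deg_below_smult)
qed simp

section \<open>Eigenpolynomials\<close>

text \<open>
  Since \<open>L\<close> is bidiagonal in the Newton basis, an eigenvector is found by solving for its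
  coefficients from the top down; \<open>newton_coeff n j\<close> belongs to \<open>nu (n - j)\<close>.
\<close>

primrec newton_coeff :: "nat \<Rightarrow> nat \<Rightarrow> real" where
  "newton_coeff n 0 = 1"
| "newton_coeff n (Suc j) = newton_coeff n j * tau (n - j) / (lam n - lam (n - Suc j))"

definition P :: "nat \<Rightarrow> real poly" where
  "P n = (\<Sum>j\<le>n. smult (newton_coeff n j) (nu (n - j)))"

lemma P_eigen:
  assumes "inj lam"
  shows "L (P n) = smult (lam n) (P n)"
proof -
  define A where "A j = smult (newton_coeff n j * (lam n - lam (n - j))) (nu (n - j))" for j
  define B where "B j = smult (newton_coeff n j * tau (n - j)) (nu (n - j - 1))" for j
  have "A (Suc j) = B j" if "j < n" for j
  proof -
    have "lam n - lam (n - Suc j) \<noteq> 0"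
      using injD[OF assms, of n "n - Suc j"] that by auto
    then show ?thesis by (simp add: A_def B_def)
  qed
  then have "(\<Sum>j<n. A (Suc j)) = (\<Sum>j<n. B j)"
    by (intro sum.cong) auto
  moreover have "(\<Sum>j\<le>n. A j) = (\<Sum>j<n. A (Suc j))"
    by (simp add: sum.atMost_shift A_def)
  moreover have "(\<Sum>j\<le>n. B j) = (\<Sum>j<n. B j)"
    by (simp add: lessThan_Suc_atMost[symmetric] B_def)
  moreover have "smult (lam n) (P n) - L (P n) = (\<Sum>j\<le>n. A j) - (\<Sum>j\<le>n. B j)"
    unfolding P_def L_sum smult_sum_right sum_subtractf[symmetric]
    by (intro sum.cong refl)
       (simp add: A_def B_def L_smult L_newton smult_add_right smult_diff_left right_diff_distrib
          mult.commute)
  ultimately show ?thesis by simp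
qed

text \<open>
  For \<open>n < 2\<close> some of the three indices \<open>n\<close>, \<open>n - 1\<close>, \<open>n - 2\<close> coincide; the coefficients
  of the spurious terms contain the factor \<open>tau 0 = 0\<close>.
\<close>

lemma P_top:
  obtains R where "deg_below (n - 2) R"
    and "P n = nu n + smult (newton_coeff n 1) (nu (n - 1))
                 + smult (newton_coeff n 2) (nu (n - 2)) + R"
proof (cases "n < 2")
  case True
  then have "n = 0 \<or> n = 1" by auto
  then have "P n = nu n + smult (newton_coeff n 1) (nu (n - 1))
                 + smult (newton_coeff n 2) (nu (n - 2)) + 0"
    by (auto simp: P_def numeral_2_eq_2)
  then show ?thesis
    by (rule that[rotated]) simp
next
  case False
  then obtain m where n: "n = Suc (Suc m)"
    by (metis Suc_diff_Suc not_less numeral_2_eq_2 Suc_le_D le_SucE Suc_le_mono)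
  define R where "R = (\<Sum>j<m. smult (newton_coeff n (Suc (Suc (Suc j)))) (nu (m - Suc j)))"
  show ?thesis
  proof (rule that)
    show "deg_below (n - 2) R"
      unfolding R_def n by (intro deg_below_sum deg_below_smult deg_below_newton) auto
    show "P n = nu n + smult (newton_coeff n 1) (nu (n - 1))
                 + smult (newton_coeff n 2) (nu (n - 2)) + R"
      unfolding P_def R_def n lessThan_Suc_atMost[symmetric] sum.lessThan_Suc_shift
      by (simp add: numeral_2_eq_2 add.assoc del: newton_coeff.simps(2))
  qed
qed

lemma deg_below_P: "deg_below (Suc n) (P n)"
  unfolding P_def by (intro deg_below_sum deg_below_smult deg_below_newton) auto

lemma coeff_P_self [simp]: "coeff (P n) n = 1"
proof -
  have "coeff (P n) n = (\<Sum>j\<le>n. if j = 0 then 1 else 0)"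
    unfolding P_def coeff_sum by (intro sum.cong) (auto simp: coeff_eq_0)
  then show ?thesis by simp
qed

lemma degree_P [simp]: "degree (P n) = n"
  using deg_below_P[of n] coeff_P_self[of n]
  by (metis deg_below_iff le_degree less_Suc_eq_le order_antisym zero_neq_one coeff_0)

text \<open>
  A polynomial of lower degree cannot be an eigenvector for \<open>lam n\<close>: its leading coefficient
  would be multiplied by another eigenvalue.
\<close>

lemma bannai_ito_eq_P:
  assumes "inj lam"
  shows "bannai_ito r1 r2 \<rho>1 \<rho>2 n = P n"
  unfolding bannai_ito_def
proof (rule the_equality)
  show "degree (P n) = n \<and> lead_coeff (P n) = 1 \<and> bi_eigenpoly r1 r2 \<rho>1 \<rho>2 n (P n)"
    using P_eigen[OF assms] by (simp add: eigenpoly_iff)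
next
  fix p assume p: "degree p = n \<and> lead_coeff p = 1 \<and> bi_eigenpoly r1 r2 \<rho>1 \<rho>2 n p"
  define q where "q = p - P n"
  have "coeff q k = 0" if "k \<ge> n" for k
    using that p by (cases "k = n") (auto simp: q_def coeff_eq_0)
  then have q: "deg_below n q"
    by (simp add: deg_below_def)
  have "q + P n = p"
    by (simp add: q_def)
  then have "L q + L (P n) = L p"
    by (metis L_add)
  then have Lq: "L q = smult (lam n) q"
    using p P_eigen[OF assms, of n] by (simp add: q_def eigenpoly_iff smult_diff_right algebra_simps)
  have "q = 0"
  proof (rule ccontr)
    assume "q \<noteq> 0"
    then have "degree q < n"
      using q by (simp add: deg_below_iff)
    moreover have "deg_below (Suc (degree q)) q"
      by (simp add: deg_below_iff)
    then have "lam n * lead_coeff q = lam (degree q) * lead_coeff q"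
      using L_triangular[of "degree q" q] unfolding Lq coeff_smult by blast
    ultimately show False
      using \<open>q \<noteq> 0\<close> injD[OF assms] by force
  qed
  then show "p = P n" by (simp add: q_def)
qed

section \<open>The three-term recurrence\<close>

text \<open>
  Rescaled operators for which the relations of the Bannai-Ito algebra take their symmetric
  form: \<open>K\<close> is an affine function of \<open>L\<close> whose eigenvalues satisfy
  \<open>\<bar>mu (n + 1) + mu n\<bar> = 1\<close>, and \<open>Y\<close> is multiplication by \<open>x + 1/4\<close>, the signed distance of \<open>x\<close>
  from the midpoint of the centres \<open>0\<close> and \<open>-1/2\<close> of the two reflections.
\<close>

definition g :: real where "g = \<rho>1 + \<rho>2 - r1 - r2"
definition K :: "real poly \<Rightarrow> real poly" where "K p = smult 2 (L p) + smult (g + 1/2) p"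
definition Y :: "real poly \<Rightarrow> real poly" where "Y p = [:1/4, 1:] * p"
definition J :: "real poly \<Rightarrow> real poly" where "J p = K (Y p) + Y (K p)"
definition mu :: "nat \<Rightarrow> real" where "mu k = 2 * lam k + (g + 1/2)"
definition y :: "nat \<Rightarrow> real" where "y k = node k + 1/4"

lemma K_lincomb: "K (smult c p + q) = smult c (K p) + K q"
  unfolding K_def L_lincomb smult_add_right by (simp add: ac_simps)

lemma Y_lincomb: "Y (smult c p + q) = smult c (Y p) + Y q"
  by (simp add: Y_def distrib_left smult_add_right ac_simps)

lemma J_lincomb: "J (smult c p + q) = smult c (J p) + J q"
  unfolding J_def K_lincomb Y_lincomb smult_add_right by (simp add: ac_simps)

lemma K_add: "K (p + q) = K p + K q"
  using K_lincomb[of 1 p q] by simp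

lemma K_0 [simp]: "K 0 = 0"
  by (simp add: K_def)

lemma K_smult: "K (smult c p) = smult c (K p)"
  using K_lincomb[of c p 0] by simp

lemma Y_smult: "Y (smult c p) = smult c (Y p)"
  by (simp add: Y_def)

lemma Y_add: "Y (p + q) = Y p + Y q"
  using Y_lincomb[of 1 p q] by simp

lemma J_add: "J (p + q) = J p + J q"
  using J_lincomb[of 1 p q] by simp

lemma J_smult: "J (smult c p) = smult c (J p)"
  by (simp add: J_def K_smult Y_smult smult_add_right)

lemma K_newton: "K (nu k) = smult (mu k) (nu k) + smult (2 * tau k) (nu (k - 1))"
  by (simp add: K_def L_newton mu_def smult_add_right smult_add_left)

lemma Y_newton: "Y (nu k) = nu (Suc k) + smult (y k) (nu k)"
  using newton_mult_X[of r1 k] by (simp add: Y_def y_def smult_add_left algebra_simps)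

lemma mu_eq: "mu k = (- 1) ^ k * (real k + g + 1/2)"
  by (simp add: mu_def bi_eigenvalue_def g_def algebra_simps)

lemma y_eq: "y k = (- 1) ^ k * (r1 - 1/4 - real k / 2)"
  by (simp add: y_def bi_grid_def)

lemma mu_Suc: "mu (Suc k) + mu k = - ((- 1) ^ k)"
  by (simp add: mu_eq algebra_simps)

lemma y_Suc: "y (Suc k) + y k = (- 1) ^ k / 2"
  by (simp add: y_eq field_simps)

definition J_diag :: "nat \<Rightarrow> real" where
  "J_diag k = 2 * tau (Suc k) + 2 * y k * mu k + 2 * tau k"

lemma J_newton:
  "J (nu k) = smult (- ((- 1) ^ k)) (nu (Suc k)) + smult (J_diag k) (nu k)
     + smult (2 * tau k * (- ((- 1) ^ k) / 2)) (nu (k - 1))"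
proof -
  \<comment> \<open>At \<open>k = 0\<close>, where \<open>nu (k - 1)\<close> is not the predecessor, both sides are \<open>0\<close>.\<close>
  have Y_pred: "smult (tau k) (Y (nu (k - 1))) = smult (tau k) (nu k + smult (y (k - 1)) (nu (k - 1)))"
    by (cases k) (simp_all add: Y_newton)
  have y_pred: "tau k * (y k + y (k - 1)) = tau k * (- ((- 1) ^ k) / 2)"
  proof (cases k)
    case (Suc m)
    then show ?thesis using y_Suc[of m] by simp
  qed simp
  have "J (nu k) = K (nu (Suc k)) + smult (y k) (K (nu k)) + smult (mu k) (Y (nu k))
      + smult 2 (smult (tau k) (Y (nu (k - 1))))"
    by (simp only: J_def Y_newton K_newton[of k] K_add K_smult Y_add Y_smult smult_smult add.assoc)
  also have "\<dots> = smult (mu (Suc k) + mu k) (nu (Suc k)) + smult (J_diag k) (nu k)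
      + smult (2 * (tau k * (y k + y (k - 1)))) (nu (k - 1))"
    unfolding Y_pred unfolding K_newton Y_newton J_diag_def
    by (rule poly_eq_poly_eq_iff[THEN iffD1], rule ext) (simp add: algebra_simps)
  finally show ?thesis
    unfolding mu_Suc y_pred by (simp only: mult.assoc)
qed

text \<open>
  \<open>J\<close> is tridiagonal in the Newton basis with entries that depend only on the parity of the
  index, apart from the factor \<open>tau\<close>.  This makes the anticommutator of \<open>J\<close> and \<open>K\<close> affine
  in \<open>K\<close> and \<open>Y\<close>.
\<close>

lemma J_diag_parity: "J_diag k = J_diag (if even k then 0 else 1)"
proof (cases "even k")
  case True
  then obtain m where k: "k = 2 * m" by (elim evenE)
  show ?thesis
    by (simp add: k J_diag_def mu_eq y_eq tau_def g_def) (simp add: field_simps)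
next
  case False
  then obtain m where "k = 2 * m + 1" by (elim oddE)
  then have k: "k = Suc (2 * m)" by simp
  show ?thesis
    by (simp add: k J_diag_def mu_eq y_eq tau_def g_def) (simp add: field_simps)
qed

lemma anticommutator_K_J:
  obtains a b where "\<And>p. K (J p) + J (K p) = Y p + smult a (K p) + smult b p"
proof -
  define a where "a = J_diag 0 + J_diag 1 - 1/2"
  define b where "b = 2 * J_diag 0 * mu 0 - 2 * tau 1 - y 0 - a * mu 0"
  have diag: "- ((- 1) ^ k) * (2 * tau (Suc k)) + 2 * tau k * (- 1) ^ k + 2 * J_diag k * mu k
      = y k + a * mu k + b" for k
  proof (cases "even k")
    case True
    then have "J_diag k = J_diag 0" using J_diag_parity[of k] by simp
    moreover obtain m where k: "k = 2 * m" using True by (elim evenE)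
    ultimately show ?thesis
      unfolding a_def b_def
      by (simp add: k J_diag_def mu_eq y_eq tau_def g_def) (simp add: field_simps)
  next
    case False
    then have "J_diag k = J_diag 1" using J_diag_parity[of k] by simp
    moreover obtain m where "k = 2 * m + 1" using False by (elim oddE)
    then have k: "k = Suc (2 * m)" by simp
    ultimately show ?thesis
      unfolding a_def b_def
      by (simp add: k J_diag_def mu_eq y_eq tau_def g_def) (simp add: field_simps)
  qed
  have basis: "K (J (nu k)) + J (K (nu k)) = Y (nu k) + smult a (K (nu k)) + smult b (nu k)" for k
  proof -
    define e :: real where "e = (- 1) ^ k"
    have J_pred: "smult (tau k) (J (nu (k - 1))) = smult (tau k)
        (smult e (nu k) + smult (J_diag (k - 1)) (nu (k - 1)) + smult (tau (k - 1) * e) (nu (k - 1 - 1)))"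
      by (cases k) (simp_all add: J_newton e_def)
    have J: "J (nu k) = smult (- e) (nu (Suc k)) + smult (J_diag k) (nu k)
        + smult (- (tau k * e)) (nu (k - 1))"
      by (simp add: e_def J_newton)
    have up: "- e * (mu (Suc k) + mu k) = 1"
      unfolding mu_Suc e_def by (simp flip: power_mult_distrib)
    have mid: "- e * (2 * tau (Suc k)) + 2 * tau k * e + 2 * J_diag k * mu k = y k + a * mu k + b"
      unfolding e_def by (rule diag)
    have down: "tau k * (2 * (J_diag k + J_diag (k - 1)) - e * (mu (k - 1) + mu k)) = 2 * a * tau k"
    proof (cases k)
      case (Suc m)
      have "J_diag k + J_diag m = J_diag 0 + J_diag 1"
        using J_diag_parity[of k] J_diag_parity[of m] by (auto simp: Suc)
      moreover have "e * (mu m + mu k) = 1"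
        using mu_Suc[of m] by (simp add: Suc e_def add.commute flip: power_mult_distrib)
      ultimately show ?thesis
        by (simp add: Suc a_def)
    qed simp
    have "K (J (nu k)) + J (K (nu k))
        = smult (- e) (K (nu (Suc k))) + smult (J_diag k) (K (nu k))
          + smult (- (tau k * e)) (K (nu (k - 1)))
          + smult (mu k) (J (nu k)) + smult 2 (smult (tau k) (J (nu (k - 1))))"
      by (simp only: J K_newton[of k] K_add K_smult J_add J_smult smult_smult add.assoc)
    also have "\<dots> = Y (nu k) + smult a (K (nu k)) + smult b (nu k)"
    proof (rule poly_eq_poly_eq_iff[THEN iffD1], rule ext)
      fix x
      show "poly (smult (- e) (K (nu (Suc k))) + smult (J_diag k) (K (nu k))
          + smult (- (tau k * e)) (K (nu (k - 1)))
          + smult (mu k) (J (nu k)) + smult 2 (smult (tau k) (J (nu (k - 1))))) x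
        = poly (Y (nu k) + smult a (K (nu k)) + smult b (nu k)) x"
        using up mid down
        unfolding J_pred J K_newton Y_newton diff_Suc_1
        by (simp only: poly_add poly_smult) algebra
    qed
    finally show ?thesis .
  qed
  have "K (J p) + J (K p) = Y p + smult a (K p) + smult b p" for p
  proof -
    have "deg_below (Suc (degree p)) p"
      by (simp add: deg_below_iff)
    then show ?thesis
    proof (induction p rule: newton_induct[where r = r1])
      case (lincomb p q c)
      have "K (J (smult c p + q)) + J (K (smult c p + q))
          = smult c (K (J p) + J (K p)) + (K (J q) + J (K q))"
        unfolding K_lincomb J_lincomb smult_add_right by (simp add: ac_simps)
      then show ?case
        unfolding lincomb K_lincomb Y_lincomb smult_add_right by (simp add: ac_simps)
    next
      case zero
      show ?case by (simp add: J_def Y_def)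
    qed (rule basis)
  qed
  then show ?thesis by (rule that)
qed

lemma K_triangular:
  assumes "deg_below (Suc n) p"
  shows "deg_below (Suc n) (K p) \<and> coeff (K p) n = mu n * coeff p n"
  using L_triangular[OF assms] assms
  by (simp add: K_def mu_def deg_below_add deg_below_smult algebra_simps)

definition rec_b :: "nat \<Rightarrow> real" where
  "rec_b n = node n + newton_coeff n 1 - newton_coeff (Suc n) 1"

definition rec_u :: "nat \<Rightarrow> real" where
  "rec_u n = newton_coeff n 1 * node (n - 1) + newton_coeff n 2 - newton_coeff (Suc n) 2
     - rec_b n * newton_coeff n 1"

text \<open>
  \<open>rec_b\<close> and \<open>rec_u\<close> are what comparing the Newton coefficients of index \<open>n\<close> and \<open>n - 1\<close>
  dictates; so the recurrence holds up to lower terms.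
\<close>

lemma recurrence_remainder:
  "deg_below m ([:0, 1:] * P (Suc m) - P (Suc (Suc m)) - smult (rec_b (Suc m)) (P (Suc m))
      - smult (rec_u (Suc m)) (P m))"
proof -
  define e where "e = newton_coeff (Suc m) 1"
  define f where "f = newton_coeff (Suc m) 2"
  define e' where "e' = newton_coeff (Suc (Suc m)) 1"
  define f' where "f' = newton_coeff (Suc (Suc m)) 2"
  obtain R0 where R0: "deg_below (m - 1) R0"
    and P0: "P (Suc m) = nu (Suc m) + smult e (nu m) + smult f (nu (m - 1)) + R0"
    using P_top[of "Suc m"] unfolding e_def f_def by (auto simp: numeral_2_eq_2)
  obtain R1 where R1: "deg_below m R1"
    and P1: "P (Suc (Suc m)) = nu (Suc (Suc m)) + smult e' (nu (Suc m)) + smult f' (nu m) + R1"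
    using P_top[of "Suc (Suc m)"] unfolding e'_def f'_def by (auto simp: numeral_2_eq_2)
  define R2 where "R2 = P m - nu m"
  have R2: "deg_below m R2"
    unfolding deg_below_def
  proof (intro allI impI)
    fix k assume "m \<le> k"
    then show "coeff R2 k = 0"
      by (cases "k = m") (auto simp: R2_def coeff_eq_0)
  qed
  define T where "T = smult f (nu (m - 1)) + R0"
  have T: "deg_below m T \<and> deg_below m ([:0, 1:] * T - smult f (nu m))"
  proof (cases m)
    case 0
    have "f = 0"
      by (simp add: f_def 0 numeral_2_eq_2)
    moreover have "R0 = 0"
      using R0 by (simp add: 0 deg_below_iff)
    ultimately show ?thesis by (simp add: T_def)
  next
    case (Suc l)
    have "[:0, 1:] * T - smult f (nu m) = smult (f * node l) (nu l) + [:0, 1:] * R0"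
      using newton_mult_X[of r1 l] by (simp add: T_def Suc distrib_left smult_add_right)
    moreover have "deg_below m \<dots>"
      using deg_below_mult_X[OF R0] unfolding Suc
      by (intro deg_below_add deg_below_smult deg_below_newton) simp_all
    moreover have "deg_below m T"
      using deg_below_mono[OF R0] unfolding T_def Suc
      by (intro deg_below_add deg_below_smult deg_below_newton) simp_all
    ultimately show ?thesis by simp
  qed
  have u: "rec_u (Suc m) = e * node m + f - f' - rec_b (Suc m) * e"
    by (simp add: rec_u_def e_def f_def f'_def)
  have b: "rec_b (Suc m) = node (Suc m) + e - e'"
    by (simp add: rec_b_def e_def e'_def)
  have PT: "P (Suc m) = nu (Suc m) + smult e (nu m) + T" and Pm: "P m = nu m + R2"
    by (simp_all add: P0 T_def R2_def add.assoc)
  have X: "[:0, 1:] * P (Suc m) = (nu (Suc (Suc m)) + smult (node (Suc m)) (nu (Suc m)))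
      + smult e (nu (Suc m) + smult (node m) (nu m)) + [:0, 1:] * T"
    unfolding PT distrib_left mult_smult_right newton_mult_X ..
  have "[:0, 1:] * P (Suc m) - P (Suc (Suc m)) - smult (rec_b (Suc m)) (P (Suc m))
      - smult (rec_u (Suc m)) (P m)
    = ([:0, 1:] * T - smult f (nu m)) - R1 - smult (rec_b (Suc m)) T - smult (rec_u (Suc m)) R2"
    unfolding X unfolding PT P1 Pm u unfolding b
    by (rule poly_eq_poly_eq_iff[THEN iffD1], rule ext) (simp add: algebra_simps)
  then show ?thesis
    using T R1 R2 by (simp add: deg_below_diff deg_below_smult)
qed

text \<open>
  Applying the anticommutator relation to \<open>P n\<close>, on which \<open>K\<close> acts as \<open>mu n\<close>, shows that
  \<open>(K + mu n)\<^sup>2 - 1\<close> maps \<open>Y (P n)\<close> to a multiple of \<open>P n\<close>.  This operator vanishes precisely on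
  \<open>P (n + 1)\<close> and \<open>P (n - 1)\<close>, so it maps the remainder of the recurrence to a multiple of
  \<open>P n\<close> as well.  The remainder has degree below \<open>n - 1\<close>, which forces the multiple to be
  \<open>0\<close> and then the remainder itself, as no eigenvalue of lower index annihilates it.
\<close>

lemma P_recurrence:
  assumes "inj lam"
  shows "[:0, 1:] * P (Suc m) = P (Suc (Suc m)) + smult (rec_b (Suc m)) (P (Suc m))
      + smult (rec_u (Suc m)) (P m)"
proof -
  define n where "n = Suc m"
  define D where "D = [:0, 1:] * P n - P (Suc n) - smult (rec_b n) (P n) - smult (rec_u n) (P m)"
  define Q where "Q p = K (K p) + smult (2 * mu n) (K p) + smult ((mu n)\<^sup>2 - 1) p" for p
  have D: "deg_below m D"
    unfolding D_def n_def by (rule recurrence_remainder)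
  have KP: "K (P k) = smult (mu k) (P k)" for k
    by (simp add: K_def P_eigen[OF assms] mu_def smult_add_left)
  have Q_lincomb: "Q (smult c p + q) = smult c (Q p) + Q q" for c p q
    unfolding Q_def K_lincomb by (simp add: smult_add_right mult.commute)
  have QP: "Q (P k) = smult ((mu k + mu n)\<^sup>2 - 1) (P k)" for k
    by (simp add: Q_def KP K_smult smult_add_left[symmetric] power2_eq_square algebra_simps
        del: smult_add_left)
  have "mu (Suc n) + mu n = - ((- 1) ^ n)" "mu n + mu m = (- 1) ^ n"
    using mu_Suc[of n] mu_Suc[of m] by (simp_all add: n_def)
  moreover have "((- 1 :: real) ^ n)\<^sup>2 = 1"
    by (simp flip: power_mult)
  ultimately have Q_neighbours: "Q (P (Suc n)) = 0" "Q (P m) = 0"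
    by (simp_all add: QP add.commute)
  note mu_neighbours = \<open>mu (Suc n) + mu n = _\<close> \<open>mu n + mu m = _\<close>
  have other: "(mu d + mu n)\<^sup>2 - 1 \<noteq> 0" if "d < m" for d
  proof
    assume "(mu d + mu n)\<^sup>2 - 1 = 0"
    then have "mu d + mu n = 1 \<or> mu d + mu n = - 1"
      by (simp add: power2_eq_1_iff)
    moreover have "(- 1 :: real) ^ n = 1 \<or> (- 1 :: real) ^ n = - 1"
      by (cases "even n") auto
    ultimately have "mu d = mu (Suc n) \<or> mu d = mu m"
      using mu_neighbours by auto
    then have "lam d = lam (Suc n) \<or> lam d = lam m"
      by (simp add: mu_def)
    then show False
      using that injD[OF assms] by (fastforce simp: n_def)
  qed
  obtain a b where ab: "\<And>p. K (J p) + J (K p) = Y p + smult a (K p) + smult b p"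
    using anticommutator_K_J by blast
  have QY: "Q (Y (P n)) = smult (a * mu n + b) (P n)"
  proof -
    have "Q (Y (P n)) = K (J (P n)) + J (K (P n)) - Y (P n)"
      unfolding J_def KP K_add Y_smult K_smult Q_def
      by (rule poly_eq_poly_eq_iff[THEN iffD1], rule ext)
         (simp add: algebra_simps power2_eq_square)
    then show ?thesis
      unfolding ab unfolding KP by (simp add: smult_add_left)
  qed
  have Y: "Y (P n) = smult (rec_b n + 1/4) (P n)
      + (smult (rec_u n) (P m) + (smult 1 (P (Suc n)) + D))"
    by (simp add: Y_def D_def smult_add_left)
  obtain q where "Q (P n) = smult q (P n)"
    using QP by blast
  then have "Q D = smult (a * mu n + b - (rec_b n + 1/4) * q) (P n)"
    using QY unfolding Y Q_lincomb Q_neighbours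
    by (simp add: smult_diff_left eq_diff_eq add.commute)
  then obtain c where QD: "Q D = smult c (P n)" by blast
  have Q_triangular: "deg_below (Suc d) (Q p) \<and> coeff (Q p) d = ((mu d + mu n)\<^sup>2 - 1) * coeff p d"
    if "deg_below (Suc d) p" for d p
  proof -
    note 1 = K_triangular[OF that] and 2 = K_triangular[of d "K p"]
    show ?thesis
      using 1 2 that unfolding Q_def
      by (auto intro!: deg_below_add deg_below_smult simp: power2_eq_square algebra_simps)
  qed
  have "D = 0"
  proof (rule ccontr)
    assume "D \<noteq> 0"
    then have d: "degree D < m"
      using D by (simp add: deg_below_iff)
    have DS: "deg_below (Suc (degree D)) D"
      by (simp add: deg_below_iff)
    have "deg_below n (Q D)"
      using Q_triangular[OF DS] d by (auto intro: deg_below_mono simp: n_def)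
    then have "coeff (Q D) n = 0"
      by (simp add: deg_below_def)
    then have "Q D = 0"
      by (simp add: QD)
    then have "((mu (degree D) + mu n)\<^sup>2 - 1) * lead_coeff D = 0"
      using Q_triangular[OF DS] by simp
    then show False
      using other[OF d] \<open>D \<noteq> 0\<close> by simp
  qed
  then show ?thesis
    unfolding D_def n_def by (simp add: algebra_simps)
qed

lemma P_recurrence_0: "[:0, 1:] * P 0 = P 1 + smult (rec_b 0) (P 0)"
  using newton_mult_X[of r1 0] by (simp add: P_def rec_b_def)

text \<open>
  Both \<open>lam n - lam (n - 1) = \<plusminus>(n + g)\<close> and \<open>lam n - lam (n - 2) = \<plusminus>1\<close> are explicit, and the
  denominators \<open>n + 1 + g\<close> cancel from \<open>rec_u n\<close>.
\<close>

lemma rec_u_eq: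
  assumes "inj lam" and "n \<ge> 1"
  shows "n + g \<noteq> 0" and "rec_u n * (n + g)\<^sup>2
    = tau n * ((n + g) * ((- 1) ^ n * (node (n - 1) - node n) + tau (n - 1) - tau (n + 1)) - tau n)"
proof -
  define s :: real where "s = (- 1) ^ n"
  have s: "s * s = 1"
    by (simp add: s_def flip: power_mult_distrib)
  obtain m where n: "n = Suc m"
    using assms(2) by (cases n) auto
  have div_s: "z / s = s * z" for z
    by (cases "even n") (simp_all add: s_def)
  have lam1: "lam n - lam m = s * (n + g)" and lam1': "lam (Suc n) - lam n = - s * (n + 1 + g)"
    by (cases "even m"; simp add: n s_def bi_eigenvalue_def g_def field_simps)+
  have lam2: "lam (Suc n) - lam m = - s"
    by (cases "even m"; simp add: n s_def bi_eigenvalue_def g_def field_simps)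
  have ng: "s * (n + g) \<noteq> 0" and ng': "s * (n + 1 + g) \<noteq> 0"
    using lam1 lam1' injD[OF assms(1), of n m] injD[OF assms(1), of "Suc n" n] by (auto simp: n)
  then show "n + g \<noteq> 0" by simp
  define e where "e = newton_coeff n 1"
  define e' where "e' = newton_coeff (Suc n) 1"
  have e: "e * (n + g) = s * tau n"
  proof -
    have "e = tau n / (s * (n + g))"
      using lam1 by (simp add: e_def n)
    then have "s * (e * (n + g)) = tau n"
      using ng by (simp add: field_simps)
    then have "(s * s) * (e * (n + g)) = s * tau n"
      by simp
    then show ?thesis
      by (simp add: s)
  qed
  have e': "e' * (n + 1 + g) = - s * tau (Suc n)"
  proof -
    have "e' = tau (Suc n) / (- s * (n + 1 + g))"
      using lam1' by (simp add: e'_def)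
    then have "tau (Suc n) = - s * (e' * (n + 1 + g))"
      using ng' by (simp add: field_simps)
    then have "(s * s) * (e' * (n + 1 + g)) = - s * tau (Suc n)"
      by simp
    then show ?thesis
      by (simp add: s)
  qed
  have f: "newton_coeff n 2 = s * e * tau m"
  proof (cases m)
    case 0
    then show ?thesis by (simp add: n numeral_2_eq_2)
  next
    case (Suc l)
    have "lam n - lam l = s"
      by (cases "even l"; simp add: n Suc s_def bi_eigenvalue_def field_simps)
    moreover have "newton_coeff n 2 = e * tau m / (lam n - lam l)"
      by (simp add: e_def n Suc numeral_2_eq_2)
    ultimately show ?thesis
      by (simp add: div_s)
  qed
  have f': "newton_coeff (Suc n) 2 = - s * e' * tau n"
  proof -
    have "newton_coeff (Suc n) 2 = e' * tau n / (lam (Suc n) - lam m)"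
      by (simp add: e'_def n numeral_2_eq_2)
    then show ?thesis
      by (simp add: lam2 div_s)
  qed
  have "rec_u n = e * node m + newton_coeff n 2 - newton_coeff (Suc n) 2 - (node n + e - e') * e"
    by (simp add: rec_u_def rec_b_def e_def e'_def n)
  then have "rec_u n = e * (node m - node n - e) + s * e * tau m + e' * (e + s * tau n)"
    unfolding f f' by algebra
  also have "e + s * tau n = e * (n + 1 + g)"
    using e by (simp add: algebra_simps)
  finally have "rec_u n = e * (node m - node n - e) + s * e * tau m + e * (e' * (n + 1 + g))"
    by (simp add: mult.left_commute)
  then have "rec_u n = e * (node m - node n - e + s * tau m - s * tau (Suc n))"
    unfolding e' by algebra
  then have "rec_u n * (n + g)\<^sup>2
      = (e * (n + g)) * ((n + g) * (node m - node n + s * (tau m - tau (Suc n))) - e * (n + g))"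
    by algebra
  also have "\<dots> = tau n * ((n + g) * (s * (node m - node n) + tau m - tau (Suc n)) - tau n)"
    unfolding e using s by algebra
  finally show "rec_u n * (n + g)\<^sup>2
    = tau n * ((n + g) * ((- 1) ^ n * (node (n - 1) - node n) + tau (n - 1) - tau (n + 1)) - tau n)"
    by (simp add: n s_def)
qed

lemma rec_u_even:
  assumes "inj lam" and "n \<ge> 1" and "even n"
  shows "rec_u n = - (n * (n + 2 * \<rho>1 + 2 * \<rho>2) * (n - 2 * r1 - 2 * r2) * (n + 2 * g))
    / (16 * (n + g)\<^sup>2)"
proof -
  obtain l where "n = 2 * l" using \<open>even n\<close> by (elim evenE)
  with \<open>n \<ge> 1\<close> obtain m where n: "n = Suc (Suc (2 * m))"
    by (cases l) auto
  have "16 * (rec_u n * (n + g)\<^sup>2) = - (n * (n + 2 * \<rho>1 + 2 * \<rho>2) * (n - 2 * r1 - 2 * r2) * (n + 2 * g))"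
    unfolding rec_u_eq(2)[OF assms(1,2)]
    by (simp add: n tau_def grid_odd grid_Suc_odd g_def) (simp add: field_simps)
  then show ?thesis
    using rec_u_eq(1)[OF assms(1,2)] by (simp add: field_simps)
qed

lemma rec_u_odd:
  assumes "inj lam" and "odd n"
  shows "rec_u n = - ((n + 2 * \<rho>1 - 2 * r1) * (n + 2 * \<rho>1 - 2 * r2) * (n + 2 * \<rho>2 - 2 * r1)
      * (n + 2 * \<rho>2 - 2 * r2)) / (16 * (n + g)\<^sup>2)"
proof -
  have "n \<ge> 1" using \<open>odd n\<close> by (cases n) auto
  obtain m where "n = 2 * m + 1" using \<open>odd n\<close> by (elim oddE)
  then have n: "n = Suc (2 * m)" by simp
  have "16 * (rec_u n * (n + g)\<^sup>2) = - ((n + 2 * \<rho>1 - 2 * r1) * (n + 2 * \<rho>1 - 2 * r2)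
      * (n + 2 * \<rho>2 - 2 * r1) * (n + 2 * \<rho>2 - 2 * r2))"
    unfolding rec_u_eq(2)[OF assms(1) \<open>n \<ge> 1\<close>]
    by (simp add: n tau_def grid_odd grid_even g_def) (simp add: field_simps)
  then show ?thesis
    using rec_u_eq(1)[OF assms(1) \<open>n \<ge> 1\<close>] by (simp add: field_simps)
qed

lemma P_eq_newton:
  assumes "tau n = 0"
  shows "P n = nu n"
proof -
  have "newton_coeff n (Suc j) = 0" for j
  proof (induction j)
    case (Suc j)
    show ?case
      unfolding newton_coeff.simps(2)[of n "Suc j"] Suc.IH by simp
  qed (simp add: assms)
  then show ?thesis
    by (simp add: P_def sum.atMost_shift del: newton_coeff.simps(2))
qed

end

section \<open>Symmetry factors and self-adjointness\<close>

lemma involution_sum_symmetric: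
  fixes c p q :: "'a \<Rightarrow> real"
  assumes "finite X" and invol: "\<And>x. i (i x) = x" and c: "\<And>x. c (i x) = c x"
    and off: "\<And>x. x \<notin> X \<Longrightarrow> c x = 0"
  shows "(\<Sum>x\<in>X. c x * (p x - p (i x)) * q x) = (\<Sum>x\<in>X. c x * p x * (q x - q (i x)))"
proof -
  define X' where "X' = {x \<in> X. i x \<in> X}"
  have restrict: "(\<Sum>x\<in>X. c x * f x) = (\<Sum>x\<in>X'. c x * f x)" for f
  proof (rule sum.mono_neutral_right)
    show "\<forall>x\<in>X - X'. c x * f x = 0"
      using off c by (force simp: X'_def)
  qed (auto simp: X'_def \<open>finite X\<close>)
  have "(\<Sum>x\<in>X'. c x * (p (i x) * q x)) = (\<Sum>x\<in>X'. c x * (p x * q (i x)))"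
    by (rule sum.reindex_bij_witness[where i = i and j = i]) (auto simp: X'_def invol c)
  then have "(\<Sum>x\<in>X. c x * (p (i x) * q x)) = (\<Sum>x\<in>X. c x * (p x * q (i x)))"
    by (simp only: restrict)
  then show ?thesis
    by (simp add: algebra_simps sum_subtractf)
qed

text \<open>
  A symmetry factor makes \<open>\<phi> F\<close> and \<open>\<phi> G\<close> invariant under the two reflections, and each half
  of \<open>L\<close> is such a coefficient times a difference over one reflection.  That \<open>\<phi>\<close> vanishes
  outside \<open>X\<close> disposes of the points whose mirror image leaves \<open>X\<close>.
\<close>

lemma dunkl_shift_self_adjoint:
  assumes "symmetry_factor_on UNIV r1 r2 \<rho>1 \<rho>2 \<phi>" and "finite X"
    and off: "\<And>x. x \<notin> X \<Longrightarrow> \<phi> x = 0"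
  shows "(\<Sum>x\<in>X. \<phi> x * dunkl_shift r1 r2 \<rho>1 \<rho>2 p x * q x)
    = (\<Sum>x\<in>X. \<phi> x * p x * dunkl_shift r1 r2 \<rho>1 \<rho>2 q x)"
proof -
  define cF where "cF x = \<phi> x * dunkl_F \<rho>1 \<rho>2 x" for x
  define cG where "cG x = \<phi> x * dunkl_G r1 r2 x" for x
  have F: "(\<Sum>x\<in>X. cF x * (p x - p (- x)) * q x) = (\<Sum>x\<in>X. cF x * p x * (q x - q (- x)))"
    by (rule involution_sum_symmetric)
       (use assms in \<open>auto simp: cF_def symmetry_factor_on_def\<close>)
  have G: "(\<Sum>x\<in>X. cG x * (p x - p (- x - 1)) * q x) = (\<Sum>x\<in>X. cG x * p x * (q x - q (- x - 1)))"
    by (rule involution_sum_symmetric)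
       (use assms in \<open>auto simp: cG_def symmetry_factor_on_def\<close>)
  have "(\<Sum>x\<in>X. \<phi> x * dunkl_shift r1 r2 \<rho>1 \<rho>2 p x * q x)
      = (\<Sum>x\<in>X. cF x * (p x - p (- x)) * q x) - (\<Sum>x\<in>X. cG x * (p x - p (- x - 1)) * q x)"
    unfolding sum_subtractf[symmetric] cF_def cG_def dunkl_shift_def
    by (intro sum.cong refl) (simp add: algebra_simps)
  also have "\<dots> = (\<Sum>x\<in>X. \<phi> x * p x * dunkl_shift r1 r2 \<rho>1 \<rho>2 q x)"
    unfolding F G unfolding sum_subtractf[symmetric] cF_def cG_def dunkl_shift_def
    by (intro sum.cong refl) (simp add: algebra_simps)
  finally show ?thesis .
qed

text \<open>
  The Gamma functions split into one pair for each parameter, and each pair is designed to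
  be invariant under one reflection and to pick up the linear factor of \<open>F\<close> or \<open>G\<close> under the
  other.  For the denominator this is an identity of the entire function \<open>rGamma\<close>, so poles
  there need no exception.
\<close>

lemma gamma_factor_symmetry:
  assumes "odd_one_periodic \<sigma>"
  shows "symmetry_factor_on (gamma_factor_domain \<rho>1 \<rho>2) r1 r2 \<rho>1 \<rho>2 (gamma_factor \<sigma> r1 r2 \<rho>1 \<rho>2)"
proof -
  define h where "h \<rho> x = Gamma (\<rho> - x) * Gamma (\<rho> + 1 + x)" for \<rho> x :: real
  define k where "k r x = rGamma (r + 1/2 + x) * rGamma (r + 1/2 - x)" for r x :: real
  have factor: "gamma_factor \<sigma> r1 r2 \<rho>1 \<rho>2 x = \<sigma> x * (h \<rho>1 x * h \<rho>2 x) * (k r1 x * k r2 x)" for x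
    by (simp only: gamma_factor_def h_def k_def rGamma_inverse_Gamma divide_inverse
        inverse_mult_distrib add.commute[of 1 \<rho>2] mult_ac)
  have \<sigma>_odd: "\<sigma> (- x) = - \<sigma> x" for x
    using assms by (simp add: odd_one_periodic_def)
  have \<sigma>_shift: "\<sigma> (- x - 1) = - \<sigma> x" for x
  proof -
    have "\<sigma> ((- x - 1) + 1) = \<sigma> (- x - 1)"
      using assms unfolding odd_one_periodic_def by blast
    then show ?thesis by (simp add: \<sigma>_odd)
  qed
  have h_neg: "h \<rho> (- x) * (\<rho> + x) = h \<rho> x * (\<rho> - x)"
    if "\<rho> - x \<notin> \<int>\<^sub>\<le>\<^sub>0" "\<rho> + x \<notin> \<int>\<^sub>\<le>\<^sub>0" for \<rho> x
  proof -
    have "\<rho> - - x = \<rho> + x" "\<rho> + 1 + - x = (\<rho> - x) + 1" "\<rho> + 1 + x = (\<rho> + x) + 1"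
      by simp_all
    then show ?thesis
      by (simp only: h_def Gamma_plus1[OF that(1)] Gamma_plus1[OF that(2)] mult_ac)
  qed
  have h_shift: "h \<rho> (- x - 1) = h \<rho> x" for \<rho> x
  proof -
    have "\<rho> - (- x - 1) = \<rho> + 1 + x" "\<rho> + 1 + (- x - 1) = \<rho> - x"
      by simp_all
    then show ?thesis
      by (simp only: h_def mult.commute)
  qed
  have k_neg: "k r (- x) = k r x" for r x
    by (simp add: k_def)
  have k_shift: "k r (- x - 1) * (- x - 1 - r + 1/2) = k r x * (x - r + 1/2)" for r x
  proof -
    have "r + 1/2 + (- x - 1) = r - 1/2 - x" "r + 1/2 - (- x - 1) = r + 1/2 + x + 1"
      "- x - 1 - r + 1/2 = - (r + 1/2 + x)" "x - r + 1/2 = - (r - 1/2 - x)"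
      "r - 1/2 - x + 1 = r + 1/2 - x"
      by simp_all
    moreover note rGamma_plus1[of "r - 1/2 - x"] rGamma_plus1[of "r + 1/2 + x"]
    ultimately have "k r (- x - 1) * (- x - 1 - r + 1/2)
        = - ((r - 1/2 - x) * rGamma (r + 1/2 - x)) * rGamma (r + 1/2 + x + 1) * (r + 1/2 + x)"
      and "k r x * (x - r + 1/2)
        = - ((r + 1/2 + x) * rGamma (r + 1/2 + x + 1)) * rGamma (r + 1/2 - x) * (r - 1/2 - x)"
      by (simp_all only: k_def mult_minus_left mult_minus_right)
    then show ?thesis
      by (simp only: mult_minus_left mult_minus_right mult_ac)
  qed
  show ?thesis
    unfolding symmetry_factor_on_def
  proof (intro conjI allI impI)
    fix x assume "x \<in> gamma_factor_domain \<rho>1 \<rho>2" "- x \<in> gamma_factor_domain \<rho>1 \<rho>2"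
    then have h1: "h \<rho>1 (- x) * (\<rho>1 + x) = h \<rho>1 x * (\<rho>1 - x)"
      and h2: "h \<rho>2 (- x) * (\<rho>2 + x) = h \<rho>2 x * (\<rho>2 - x)"
      by (intro h_neg; simp add: gamma_factor_domain_def)+
    have "(h \<rho>1 (- x) * h \<rho>2 (- x)) * ((- x - \<rho>1) * (- x - \<rho>2))
        = (h \<rho>1 (- x) * (\<rho>1 + x)) * (h \<rho>2 (- x) * (\<rho>2 + x))"
      by algebra
    also have "\<dots> = (h \<rho>1 x * h \<rho>2 x) * ((x - \<rho>1) * (x - \<rho>2))"
      unfolding h1 h2 by algebra
    finally have "(h \<rho>1 (- x) * h \<rho>2 (- x)) * ((- x - \<rho>1) * (- x - \<rho>2)) = \<dots>" .
    moreover have "- s * H * K * (M / (2 * - x)) = s * K * (H * M) / (2 * x)"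
      and "s * H * K * (M / (2 * x)) = s * K * (H * M) / (2 * x)" for s H K M :: real
      by simp_all
    ultimately show "gamma_factor \<sigma> r1 r2 \<rho>1 \<rho>2 (- x) * dunkl_F \<rho>1 \<rho>2 (- x)
        = gamma_factor \<sigma> r1 r2 \<rho>1 \<rho>2 x * dunkl_F \<rho>1 \<rho>2 x"
      by (simp only: factor k_neg \<sigma>_odd dunkl_F_def)
  next
    fix x
    have "(k r1 (- x - 1) * k r2 (- x - 1)) * ((- x - 1 - r1 + 1/2) * (- x - 1 - r2 + 1/2))
        = (k r1 (- x - 1) * (- x - 1 - r1 + 1/2)) * (k r2 (- x - 1) * (- x - 1 - r2 + 1/2))"
      by (simp only: mult_ac)
    also have "\<dots> = (k r1 x * k r2 x) * ((x - r1 + 1/2) * (x - r2 + 1/2))"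
      unfolding k_shift by (simp only: mult_ac)
    finally have "(k r1 (- x - 1) * k r2 (- x - 1)) * ((- x - 1 - r1 + 1/2) * (- x - 1 - r2 + 1/2))
        = \<dots>" .
    moreover have "2 * (- x - 1) + 1 = - (2 * x + 1)"
      by simp
    moreover have "- s * H * K * (M / - d) = s * H * (K * M) / d"
      and "s * H * K * (M / d) = s * H * (K * M) / d" for s H K M d :: real
      by simp_all
    ultimately show "gamma_factor \<sigma> r1 r2 \<rho>1 \<rho>2 (- x - 1) * dunkl_G r1 r2 (- x - 1)
        = gamma_factor \<sigma> r1 r2 \<rho>1 \<rho>2 x * dunkl_G r1 r2 x"
      by (simp only: factor h_shift \<sigma>_shift dunkl_G_def)
  qed
qed

lemma odd_one_periodic_grid:
  assumes "odd_one_periodic \<sigma>"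
  shows "\<sigma> (bi_grid r s) = (- 1) ^ s * \<sigma> (bi_grid r 0)"
proof -
  have shift: "\<sigma> (z - real m) = \<sigma> z" for z m
  proof (induction m)
    case (Suc m)
    have "\<sigma> ((z - real (Suc m)) + 1) = \<sigma> (z - real (Suc m))"
      using assms unfolding odd_one_periodic_def by blast
    then show ?case
      using Suc by (simp add: algebra_simps)
  qed simp
  show ?thesis
  proof (cases "even s")
    case True
    then obtain m where "s = 2 * m" by (elim evenE)
    then show ?thesis
      using shift[of "r - 1/2" m] by (simp add: grid_even grid_0)
  next
    case False
    then obtain m where "s = 2 * m + 1" by (elim oddE)
    then have s: "s = Suc (2 * m)" by simp
    have "\<sigma> (1/2 - r + real m) = \<sigma> (- (r - 1/2 - real m))"
      by (rule arg_cong[of _ _ \<sigma>]) simp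
    also have "\<dots> = - \<sigma> (r - 1/2 - real m)"
      using assms unfolding odd_one_periodic_def by blast
    finally show ?thesis
      using shift[of "r - 1/2" m] by (simp add: s grid_odd grid_0)
  qed
qed

section \<open>Weights on the grid\<close>

locale dunkl_positive = dunkl +
  fixes N :: nat
  assumes odd_N: "odd N"
    and r_sum: "r1 + r2 = (real N + 1) / 2"
    and r1_less: "r1 < 1/2"
    and inj_lam: "inj lam"
    and F_pos: "s \<le> N \<Longrightarrow> F (node s) > 0"
    and G_neg: "0 < s \<Longrightarrow> s < N \<Longrightarrow> G (node s) < 0"
begin

lemma reflect_even: "even s \<Longrightarrow> - node s = node (Suc s)"
  by (auto elim!: evenE simp: grid_even grid_odd)

lemma reflect_odd: "odd s \<Longrightarrow> - node s - 1 = node (Suc s)"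
  by (simp add: bi_grid_def field_simps)

lemma node_sign: "if even s then node s < 0 else node s > 0"
proof (cases "even s")
  case True
  then show ?thesis
    using r1_less by (auto elim!: evenE simp: grid_even)
next
  case False
  then obtain m where "s = 2 * m + 1" by (elim oddE)
  then show ?thesis
    using r1_less by (simp add: grid_odd)
qed

lemma inj_node: "inj node"
proof (rule injI)
  fix s t assume eq: "node s = node t"
  then have "even s \<longleftrightarrow> even t"
    using node_sign[of s] node_sign[of t] by (auto split: if_splits)
  then show "s = t"
    using eq by (cases "even s") (simp_all add: bi_grid_def)
qed

lemma node_N: "node N = r2 - 1/2"
  using odd_N r_sum by (simp add: bi_grid_def field_simps)

lemma G_first: "G (node 0) = 0" and G_last: "G (node N) = 0"
  by (simp_all add: dunkl_G_def grid_0 node_N)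

lemma roots_P_Suc_N: "{t. poly (P (Suc N)) t = 0} = node ` {0..N}"
proof -
  have "tau (Suc N) = 0"
    using odd_N r_sum by (simp add: tau_def field_simps)
  then show ?thesis
    by (auto simp: P_eq_newton poly_newton_eq_0_iff less_Suc_eq_le)
qed

text \<open>
  The ratio of consecutive weights is prescribed by the reflection that exchanges the two
  nodes.  It is positive, and both end nodes are zeros of \<open>G\<close>, so the weights can be extended
  by \<open>0\<close> to a symmetry factor on the whole line.
\<close>

primrec weight :: "nat \<Rightarrow> real" where
  "weight 0 = 1"
| "weight (Suc s) = weight s * (if even s then F (node s) / F (node (Suc s))
                                else G (node s) / G (node (Suc s)))"

lemma G_neg_Suc: "odd s \<Longrightarrow> s < N \<Longrightarrow> G (node s) < 0 \<and> G (node (Suc s)) < 0"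
proof -
  assume "odd s" "s < N"
  moreover from this have "Suc s \<noteq> N"
    using odd_N by auto
  ultimately show ?thesis
    using G_neg[of s] G_neg[of "Suc s"] by (simp add: odd_pos)
qed

lemma weight_pos: "s \<le> N \<Longrightarrow> weight s > 0"
proof (induction s)
  case (Suc s)
  have "(if even s then F (node s) / F (node (Suc s)) else G (node s) / G (node (Suc s))) > 0"
    using F_pos[of s] F_pos[of "Suc s"] G_neg_Suc[of s] Suc.prems by (simp add: divide_neg_neg)
  then show ?case
    using Suc by simp
qed simp

lemma weight_F: "even s \<Longrightarrow> Suc s \<le> N \<Longrightarrow> weight (Suc s) * F (node (Suc s)) = weight s * F (node s)"
  using F_pos[of "Suc s"] by simp

lemma weight_G: "odd s \<Longrightarrow> s < N \<Longrightarrow> weight (Suc s) * G (node (Suc s)) = weight s * G (node s)"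
  using G_neg_Suc[of s] by auto

definition grid_phi :: "real \<Rightarrow> real" where
  "grid_phi x = (\<Sum>s\<le>N. if x = node s then weight s else 0)"

lemma grid_phi_node: "s \<le> N \<Longrightarrow> grid_phi (node s) = weight s"
  by (simp add: grid_phi_def inj_eq[OF inj_node] sum.delta eq_commute[of s])

lemma grid_phi_off: "x \<notin> node ` {0..N} \<Longrightarrow> grid_phi x = 0"
  unfolding grid_phi_def by (intro sum.neutral) auto

lemma grid_phi_symmetry: "symmetry_factor_on UNIV r1 r2 \<rho>1 \<rho>2 grid_phi"
proof -
  let ?X = "node ` {0..N}"
  have F: "- node s \<in> ?X \<and> grid_phi (- node s) * F (- node s) = grid_phi (node s) * F (node s)"
    if "s \<le> N" for s
  proof (cases "even s")
    case True
    then have "Suc s \<le> N"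
      using that odd_N by (metis Suc_leI le_neq_implies_less)
    then show ?thesis
      using True weight_F[of s] that
      by (auto simp: reflect_even grid_phi_node simp del: weight.simps)
  next
    case False
    then obtain t where s: "s = Suc t" "even t"
      by (cases s) auto
    then have "- node s = node t"
      using reflect_even[of t] by simp
    then show ?thesis
      using s weight_F[of t] that by (auto simp: grid_phi_node simp del: weight.simps)
  qed
  have G: "grid_phi (- node s - 1) * G (- node s - 1) = grid_phi (node s) * G (node s)"
    if "s \<le> N" for s
  proof -
    have "s = 0 \<or> s = N \<or> odd s \<and> s < N \<or> (\<exists>t. s = Suc t \<and> odd t \<and> t < N)"
      using that by (cases s) auto
    then consider "s = 0" | "s = N" | "odd s" "s < N" | t where "s = Suc t" "odd t" "t < N"
      by blast
    then show ?thesis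
    proof cases
      case 1
      \<comment> \<open>The mirror image of \<open>x\<^sub>0\<close> is not on the grid, unless \<open>x\<^sub>0 = -1/2\<close> is a fixed point.\<close>
      have "- node 0 - 1 = node 0 \<or> - node 0 - 1 \<notin> ?X"
      proof (rule disjCI)
        assume "\<not> - node 0 - 1 \<notin> ?X"
        then obtain j where j: "- node 0 - 1 = node j" by auto
        show "- node 0 - 1 = node 0"
        proof (cases "even j")
          case True
          then obtain m where m: "j = 2 * m" by (elim evenE)
          then have "2 * r1 = real m"
            using j by (simp add: grid_0 grid_even)
          then have "m = 0"
            using r1_less by simp
          then show ?thesis using j m by simp
        next
          case False
          then obtain m where "j = 2 * m + 1" by (elim oddE)
          then show ?thesis
            using j by (simp add: grid_0 grid_odd)
        qed
      qed
      then show ?thesis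
        using G_first by (metis 1 grid_phi_off mult_zero_left mult_zero_right)
    next
      case 2
      have "- node N - 1 \<notin> ?X"
        using inj_eq[OF inj_node] odd_N by (auto simp: reflect_odd)
      then show ?thesis
        using G_last by (simp add: 2 grid_phi_off)
    next
      case 3
      then show ?thesis
        using weight_G[of s] by (simp add: reflect_odd grid_phi_node del: weight.simps)
    next
      case 4
      have "- node s - 1 = node t"
        using reflect_odd[of t] 4 by simp
      then show ?thesis
        using 4 weight_G[of t] that by (simp add: grid_phi_node del: weight.simps)
    qed
  qed
  have "grid_phi (- x) * F (- x) = grid_phi x * F x" for x
  proof (cases "x \<in> ?X")
    case False
    then have "- x \<notin> ?X"
      using F by force
    then show ?thesis
      using False by (simp add: grid_phi_off)
  qed (use F in auto)
  moreover have "grid_phi (- x - 1) * G (- x - 1) = grid_phi x * G x" for x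
  proof (cases "x \<in> ?X")
    case False
    then have x: "grid_phi x = 0"
      by (rule grid_phi_off)
    show ?thesis
    proof (cases "- x - 1 \<in> ?X")
      case True
      then obtain s where s: "s \<le> N" "- x - 1 = node s" by auto
      then have image: "- node s - 1 = x" by simp
      show ?thesis
        using G[OF s(1)] unfolding image s(2) x by simp
    qed (simp add: x grid_phi_off)
  qed (use G in auto)
  ultimately show ?thesis
    by (simp add: symmetry_factor_on_def)
qed

lemma symmetry_factor_eq_weight:
  assumes \<psi>: "symmetry_factor_on D r1 r2 \<rho>1 \<rho>2 \<psi>" and D: "\<And>s. s \<le> N \<Longrightarrow> node s \<in> D"
    and "s \<le> N"
  shows "\<psi> (node s) = \<psi> (node 0) * weight s"
  using \<open>s \<le> N\<close>
proof (induction s)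
  case (Suc s)
  then have IH: "\<psi> (node s) = \<psi> (node 0) * weight s" by simp
  have s: "node s \<in> D" "node (Suc s) \<in> D"
    using D Suc.prems by auto
  show ?case
  proof (cases "even s")
    case True
    then have "\<psi> (node (Suc s)) * F (node (Suc s)) = \<psi> (node s) * F (node s)"
      using \<psi> s unfolding symmetry_factor_on_def by (metis reflect_even)
    then show ?thesis
      using True F_pos[of "Suc s"] Suc.prems by (simp add: IH field_simps)
  next
    case False
    then have "\<psi> (node (Suc s)) * G (node (Suc s)) = \<psi> (node s) * G (node s)"
      using \<psi> s unfolding symmetry_factor_on_def by (metis reflect_odd)
    moreover have "G (node (Suc s)) \<noteq> 0"
      using G_neg_Suc[of s] False Suc.prems by simp
    ultimately show ?thesis
      using False by (simp add: IH field_simps)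
  qed
qed simp

lemma poly_L_node: "poly (L p) (node s) = dunkl_shift r1 r2 \<rho>1 \<rho>2 (poly p) (node s)"
proof (cases "node s = - 1/2")
  case True
  then have "even s"
    using node_sign[of s] by (auto split: if_splits)
  then obtain m where m: "s = 2 * m" by (elim evenE)
  then have "r1 = real m"
    using True by (simp add: grid_even)
  then have "s = 0"
    using r1_less by (simp add: m)
  then show ?thesis
    using poly_L_first_node[of p] True by (simp add: dunkl_shift_def)
next
  case False
  then show ?thesis
    using node_sign[of s] by (intro poly_L) (auto split: if_splits)
qed

lemma P_orthogonal:
  assumes "n \<noteq> m"
  shows "(\<Sum>s=0..N. weight s * poly (P n) (node s) * poly (P m) (node s)) = 0"
proof -
  let ?S = "\<lambda>f. \<Sum>s=0..N. weight s * f (node s)"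
  have transfer: "(\<Sum>x\<in>node ` {0..N}. grid_phi x * f x) = ?S f" for f
    by (subst sum.reindex) (auto simp: grid_phi_node intro!: sum.cong inj_on_subset[OF inj_node])
  have eig: "dunkl_shift r1 r2 \<rho>1 \<rho>2 (poly (P k)) (node s) = lam k * poly (P k) (node s)" for k s
    using P_eigen[OF inj_lam, of k] by (simp flip: poly_L_node)
  have "?S (\<lambda>x. dunkl_shift r1 r2 \<rho>1 \<rho>2 (poly (P n)) x * poly (P m) x)
      = ?S (\<lambda>x. poly (P n) x * dunkl_shift r1 r2 \<rho>1 \<rho>2 (poly (P m)) x)"
    using dunkl_shift_self_adjoint[OF grid_phi_symmetry, of "node ` {0..N}" "poly (P n)" "poly (P m)"]
    by (simp add: grid_phi_off mult.assoc transfer)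
  then have "(lam n - lam m) * ?S (\<lambda>x. poly (P n) x * poly (P m) x) = 0"
    unfolding eig left_diff_distrib sum_distrib_left
    by (simp add: ac_simps sum_subtractf)
  moreover have "lam n \<noteq> lam m"
    using assms inj_eq[OF inj_lam] by blast
  ultimately show ?thesis
    by (simp add: mult.assoc)
qed

lemma P_norm_pos:
  assumes "n \<le> N"
  shows "(\<Sum>s=0..N. weight s * poly (P n) (node s) * poly (P n) (node s)) > 0"
proof -
  have "\<exists>s\<le>N. poly (P n) (node s) \<noteq> 0"
  proof (rule ccontr)
    assume "\<not> ?thesis"
    then have "node ` {0..N} \<subseteq> {t. poly (P n) t = 0}"
      by auto
    moreover have "P n \<noteq> 0"
      using coeff_P_self[of n] by (metis coeff_0 zero_neq_one)
    ultimately have "card (node ` {0..N}) \<le> n"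
      using card_poly_roots_bound[of "P n"] card_mono[OF poly_roots_finite[of "P n"]]
      by (metis degree_P le_trans)
    then show False
      using assms by (simp add: card_image inj_on_subset[OF inj_node])
  qed
  then obtain s where s: "s \<le> N" "poly (P n) (node s) \<noteq> 0" by blast
  have "weight t * poly (P n) (node t) * poly (P n) (node t) \<ge> 0" if "t \<le> N" for t
    using weight_pos[OF that] by (simp add: mult.assoc)
  moreover have "weight s * poly (P n) (node s) * poly (P n) (node s) > 0"
    using weight_pos[OF s(1)] s(2) by (auto simp: mult.assoc zero_less_mult_iff linorder_neq_iff)
  ultimately show ?thesis
    using s(1) by (intro sum_pos2[of _ s]) auto
qed

end

section \<open>The Bannai-Ito polynomials\<close>

theorem mainTheorem12:
  fixes N :: nat
    and \<xi> \<eta> \<zeta> r1 r2 \<rho>1 \<rho>2 :: real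
    and P :: "nat \<Rightarrow> real poly"
    and x :: "nat \<Rightarrow> real"
  assumes "odd N" and "N > 1"
    and "\<xi> > 0" and "\<eta> > 0" and "\<zeta> > 0" and "\<xi> > \<zeta>" and "\<xi> \<notin> \<int>"
    and "r1 = (1 - \<zeta> - \<eta>) / 2"
    and "r2 = (\<eta> + \<zeta> + real N) / 2"
    and "\<rho>1 = (\<eta> - \<zeta>) / 2"
    and "\<rho>2 = (\<zeta> - \<eta> - 2 * \<xi> - real N + 1) / 2"
    and "P = bannai_ito r1 r2 \<rho>1 \<rho>2"
    and "x = bi_grid r1"
  shows
    "r1 + r2 = (real N + 1) / 2 \<and>
     inj (bi_eigenvalue r1 r2 \<rho>1 \<rho>2) \<and>
     (\<exists>b u :: nat \<Rightarrow> real.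
        (\<forall>n. P (n + 1) + smult (b n) (P n) + (if n = 0 then 0 else smult (u n) (P (n - 1)))
               = [:0, 1:] * P n) \<and>
        (\<forall>n\<ge>1. even n \<longrightarrow>
           u n = real n * (- real n + real N - 1 + 2 * \<xi>) * (- real n + real N + 1)
                   * (- real n + 2 * real N + 2 * \<xi>)
                 / (16 * (- real n + real N + \<xi>)\<^sup>2)) \<and>
        (\<forall>n\<ge>1. odd n \<longrightarrow>
           u n = (real n + 2 * \<eta> - 1) * (- real n + 2 * \<zeta> + real N)
                   * (- real n - 2 * \<zeta> + real N + 2 * \<xi>)
                   * (- real n + 2 * \<eta> + 2 * real N - 1 + 2 * \<xi>)
                 / (16 * (- real n + real N + \<xi>)\<^sup>2)) \<and>
        (\<forall>n\<in>{1..N}. u n > 0) \<and>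
        u (N + 1) = 0) \<and>
     inj_on x {0..N} \<and>
     {t. poly (P (N + 1)) t = 0} = x ` {0..N} \<and>
     (\<forall>\<sigma>. odd_one_periodic \<sigma> \<longrightarrow>
        symmetry_factor_on (gamma_factor_domain \<rho>1 \<rho>2) r1 r2 \<rho>1 \<rho>2
          (gamma_factor \<sigma> r1 r2 \<rho>1 \<rho>2) \<and>
        (\<exists>c. \<forall>s\<le>N. \<sigma> (x s) = (- 1) ^ s * c)) \<and>
     (\<exists>w \<kappa> :: nat \<Rightarrow> real.
        (\<forall>s\<le>N. w s > 0) \<and>
        (\<forall>n\<le>N. \<kappa> n \<noteq> 0) \<and>
        (\<forall>n\<le>N. \<forall>m\<le>N.
           (\<Sum>s = 0..N. w s * poly (P n) (x s) * poly (P m) (x s))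
             = (if n = m then (\<kappa> n)\<^sup>2 else 0)) \<and>
        (\<exists>\<phi>. symmetry_factor_on UNIV r1 r2 \<rho>1 \<rho>2 \<phi> \<and> (\<forall>s\<le>N. w s = \<phi> (x s))) \<and>
        (gamma_generic N r1 r2 \<rho>1 \<rho>2 \<longrightarrow>
           (\<exists>\<sigma>. odd_one_periodic \<sigma> \<and>
              (\<forall>s\<le>N. w s = gamma_factor \<sigma> r1 r2 \<rho>1 \<rho>2 (x s)))))"
proof -
  define M where "M = (N - 1) div 2"
  have M: "real N = 2 * real M + 1" "N = Suc (2 * M)"
    using \<open>odd N\<close> by (auto elim!: oddE simp: M_def)
  have r_sum: "r1 + r2 = (real N + 1) / 2"
    by (simp add: assms(8,9) field_simps)
  have lam: "bi_eigenvalue r1 r2 \<rho>1 \<rho>2 n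
      = (if even n then real (n div 2) else \<xi> + real N - real (Suc (n div 2)))" for n
    by (cases "even n"; auto elim!: evenE oddE simp: bi_eigenvalue_def assms(8-11) field_simps)
  have inj: "inj (bi_eigenvalue r1 r2 \<rho>1 \<rho>2)"
  proof (rule injI)
    fix n m assume eq: "bi_eigenvalue r1 r2 \<rho>1 \<rho>2 n = bi_eigenvalue r1 r2 \<rho>1 \<rho>2 m"
    have "\<xi> + real N \<noteq> real (Suc (n div 2 + m div 2))"
    proof
      assume "\<xi> + real N = real (Suc (n div 2 + m div 2))"
      then have "\<xi> = real (Suc (n div 2 + m div 2)) - real N"
        by linarith
      then have "\<xi> \<in> \<int>"
        by simp
      then show False
        using \<open>\<xi> \<notin> \<int>\<close> by contradiction
    qed
    then have "even n \<longleftrightarrow> even m"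
      using eq by (auto simp: lam algebra_simps split: if_splits)
    moreover from this have "n div 2 = m div 2"
      using eq by (simp add: lam split: if_splits)
    ultimately show "n = m"
      by (metis div_mult_mod_eq odd_iff_mod_2_eq_one even_iff_mod_2_eq_zero)
  qed
  have F_pos: "dunkl_F \<rho>1 \<rho>2 (bi_grid r1 s) > 0" if "s \<le> N" for s
  proof (cases "even s")
    case True
    then obtain m where s: "s = 2 * m" by (elim evenE)
    then have "m \<le> M" using that M(2) by simp
    moreover have x_s: "bi_grid r1 s = - (\<zeta> + \<eta>) / 2 - real m"
      unfolding s grid_even assms(8) by (simp add: field_simps)
    ultimately have "bi_grid r1 s - \<rho>1 < 0" "bi_grid r1 s - \<rho>2 > 0" "bi_grid r1 s < 0"
      using assms(3-6) unfolding x_s assms(10,11) M(1) by (simp_all add: field_simps)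
    then show ?thesis
      unfolding dunkl_F_def by (intro divide_neg_neg[OF mult_neg_pos]) auto
  next
    case False
    then obtain m where "s = 2 * m + 1" by (elim oddE)
    then have s: "s = Suc (2 * m)" by simp
    have x_s: "bi_grid r1 s = (\<zeta> + \<eta>) / 2 + real m"
      unfolding s grid_odd assms(8) by (simp add: field_simps)
    have "bi_grid r1 s - \<rho>1 > 0" "bi_grid r1 s - \<rho>2 > 0" "bi_grid r1 s > 0"
      using assms(3-6) unfolding x_s assms(10,11) M(1) by (simp_all add: field_simps)
    then show ?thesis
      unfolding dunkl_F_def by (intro divide_pos_pos[OF mult_pos_pos]) auto
  qed
  have G_neg: "dunkl_G r1 r2 (bi_grid r1 s) < 0" if "0 < s" "s < N" for s
  proof (cases "even s")
    case True
    then obtain m where s: "s = 2 * m" by (elim evenE)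
    then have "m \<ge> 1" using that by simp
    moreover have x_s: "bi_grid r1 s = - (\<zeta> + \<eta>) / 2 - real m"
      unfolding s grid_even assms(8) by (simp add: field_simps)
    ultimately have "bi_grid r1 s - r1 + 1/2 < 0" "bi_grid r1 s - r2 + 1/2 < 0" "2 * bi_grid r1 s + 1 < 0"
      using assms(4,5) unfolding x_s assms(8,9) M(1) by (simp_all add: field_simps)
    then show ?thesis
      unfolding dunkl_G_def by (intro divide_pos_neg[OF mult_neg_neg]) auto
  next
    case False
    then obtain m where "s = 2 * m + 1" by (elim oddE)
    then have s: "s = Suc (2 * m)" by simp
    then have "m < M" using that M(2) by simp
    moreover have x_s: "bi_grid r1 s = (\<zeta> + \<eta>) / 2 + real m"
      unfolding s grid_odd assms(8) by (simp add: field_simps)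
    ultimately have "bi_grid r1 s - r1 + 1/2 > 0" "bi_grid r1 s - r2 + 1/2 < 0" "2 * bi_grid r1 s + 1 > 0"
      using assms(4,5) unfolding x_s assms(8,9) M(1) by (simp_all add: field_simps)
    then show ?thesis
      unfolding dunkl_G_def by (intro divide_neg_pos[OF mult_pos_neg]) auto
  qed
  interpret D: dunkl_positive r1 r2 \<rho>1 \<rho>2 N
    using \<open>odd N\<close> r_sum inj F_pos G_neg assms(4,5) by unfold_locales (simp_all add: assms(8))
  have P: "P = D.P"
    using D.bannai_ito_eq_P[OF inj] by (simp add: assms(12) fun_eq_iff)
  have x: "x = bi_grid r1"
    by (rule assms(13))
  have g: "D.g = - \<xi> - real N"
    unfolding D.g_def unfolding assms(8-11) by (simp add: field_simps)

  have rec: "P (n + 1) + smult (D.rec_b n) (P n) + (if n = 0 then 0 else smult (D.rec_u n) (P (n - 1)))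
      = [:0, 1:] * P n" for n
    using D.P_recurrence[OF inj, of "n - 1"] D.P_recurrence_0 by (cases n) (simp_all add: P)
  have u_even: "D.rec_u n = real n * (- real n + real N - 1 + 2 * \<xi>) * (- real n + real N + 1)
      * (- real n + 2 * real N + 2 * \<xi>) / (16 * (- real n + real N + \<xi>)\<^sup>2)"
    if "n \<ge> 1" "even n" for n
  proof -
    have factors: "real n + 2 * \<rho>1 + 2 * \<rho>2 = - (- real n + real N - 1 + 2 * \<xi>)"
      "real n - 2 * r1 - 2 * r2 = - (- real n + real N + 1)"
      "real n + 2 * D.g = - (- real n + 2 * real N + 2 * \<xi>)"
      "real n + D.g = - (- real n + real N + \<xi>)"
      unfolding g unfolding assms(8-11) by (simp_all add: field_simps)
    show ?thesis
      unfolding D.rec_u_even[OF inj that] factors power2_minus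
      by (simp only: mult_minus_left mult_minus_right minus_minus)
  qed
  have u_odd: "D.rec_u n = (real n + 2 * \<eta> - 1) * (- real n + 2 * \<zeta> + real N)
      * (- real n - 2 * \<zeta> + real N + 2 * \<xi>) * (- real n + 2 * \<eta> + 2 * real N - 1 + 2 * \<xi>)
      / (16 * (- real n + real N + \<xi>)\<^sup>2)" if "odd n" for n
  proof -
    have factors: "real n + 2 * \<rho>1 - 2 * r1 = real n + 2 * \<eta> - 1"
      "real n + 2 * \<rho>1 - 2 * r2 = - (- real n + 2 * \<zeta> + real N)"
      "real n + 2 * \<rho>2 - 2 * r1 = - (- real n - 2 * \<zeta> + real N + 2 * \<xi>)"
      "real n + 2 * \<rho>2 - 2 * r2 = - (- real n + 2 * \<eta> + 2 * real N - 1 + 2 * \<xi>)"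
      "real n + D.g = - (- real n + real N + \<xi>)"
      unfolding g unfolding assms(8-11) by (simp_all add: field_simps)
    show ?thesis
      unfolding D.rec_u_odd[OF inj that] factors power2_minus
      by (simp only: mult_minus_left mult_minus_right minus_minus)
  qed
  have u_pos: "D.rec_u n > 0" if "n \<in> {1..N}" for n
  proof -
    have n: "1 \<le> real n" "real n \<le> real N"
      using that by auto
    have "- real n + real N + \<xi> \<noteq> 0"
      using n assms(3) by simp
    then have denom: "16 * (- real n + real N + \<xi>)\<^sup>2 > 0"
      by simp
    show ?thesis
    proof (cases "even n")
      case True
      then have "real n \<le> real N - 1"
        using that \<open>odd N\<close> by (cases "n = N") auto
      then have "real n * (- real n + real N - 1 + 2 * \<xi>) * (- real n + real N + 1)
          * (- real n + 2 * real N + 2 * \<xi>) > 0"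
        using n assms(3) by (intro mult_pos_pos) linarith+
      moreover have "n \<ge> 1"
        using that by simp
      ultimately show ?thesis
        unfolding u_even[OF \<open>n \<ge> 1\<close> True] using denom by (intro divide_pos_pos)
    next
      case False
      have "(real n + 2 * \<eta> - 1) * (- real n + 2 * \<zeta> + real N)
          * (- real n - 2 * \<zeta> + real N + 2 * \<xi>)
          * (- real n + 2 * \<eta> + 2 * real N - 1 + 2 * \<xi>) > 0"
        using n assms(3-6) by (intro mult_pos_pos) linarith+
      from this denom show ?thesis
        unfolding u_odd[OF False] by (rule divide_pos_pos)
    qed
  qed
  have u_zero: "D.rec_u (N + 1) = 0"
    using u_even[of "N + 1"] \<open>odd N\<close> by simp
  have recurrence: "\<exists>b u :: nat \<Rightarrow> real.
      (\<forall>n. P (n + 1) + smult (b n) (P n) + (if n = 0 then 0 else smult (u n) (P (n - 1)))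
             = [:0, 1:] * P n) \<and>
      (\<forall>n\<ge>1. even n \<longrightarrow>
         u n = real n * (- real n + real N - 1 + 2 * \<xi>) * (- real n + real N + 1)
                 * (- real n + 2 * real N + 2 * \<xi>)
               / (16 * (- real n + real N + \<xi>)\<^sup>2)) \<and>
      (\<forall>n\<ge>1. odd n \<longrightarrow>
         u n = (real n + 2 * \<eta> - 1) * (- real n + 2 * \<zeta> + real N)
                 * (- real n - 2 * \<zeta> + real N + 2 * \<xi>)
                 * (- real n + 2 * \<eta> + 2 * real N - 1 + 2 * \<xi>)
               / (16 * (- real n + real N + \<xi>)\<^sup>2)) \<and>
      (\<forall>n\<in>{1..N}. u n > 0) \<and> u (N + 1) = 0"
    by (intro exI[of _ D.rec_b] exI[of _ D.rec_u] conjI allI impI ballI)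
       (assumption | rule rec u_even u_odd u_pos u_zero)+

  define w where "w = D.weight"
  define \<kappa> where "\<kappa> n = sqrt (\<Sum>s = 0..N. w s * poly (P n) (x s) * poly (P n) (x s))" for n
  have w_pos: "\<forall>s\<le>N. w s > 0"
    by (simp add: w_def D.weight_pos)
  have norm: "(\<Sum>s = 0..N. w s * poly (P n) (x s) * poly (P n) (x s)) > 0" if "n \<le> N" for n
    using D.P_norm_pos[OF that] by (simp add: w_def P x)
  have \<kappa>: "\<forall>n\<le>N. \<kappa> n \<noteq> 0"
  proof (intro allI impI)
    fix n assume "n \<le> N"
    then show "\<kappa> n \<noteq> 0"
      using norm[of n] by (simp add: \<kappa>_def)
  qed
  have orth: "\<forall>n\<le>N. \<forall>m\<le>N. (\<Sum>s = 0..N. w s * poly (P n) (x s) * poly (P m) (x s))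
      = (if n = m then (\<kappa> n)\<^sup>2 else 0)"
  proof (intro allI impI)
    fix n m assume "n \<le> N" "m \<le> N"
    show "(\<Sum>s = 0..N. w s * poly (P n) (x s) * poly (P m) (x s)) = (if n = m then (\<kappa> n)\<^sup>2 else 0)"
    proof (cases "n = m")
      case True
      then show ?thesis
        unfolding \<kappa>_def using norm[OF \<open>n \<le> N\<close>] by simp
    next
      case False
      then show ?thesis
        using D.P_orthogonal[of n m] by (simp add: w_def P x)
    qed
  qed
  have phi: "\<exists>\<phi>. symmetry_factor_on UNIV r1 r2 \<rho>1 \<rho>2 \<phi> \<and> (\<forall>s\<le>N. w s = \<phi> (x s))"
    by (intro exI[of _ D.grid_phi] conjI D.grid_phi_symmetry) (simp add: w_def x D.grid_phi_node)
  have gamma: "\<exists>\<sigma>. odd_one_periodic \<sigma> \<and> (\<forall>s\<le>N. w s = gamma_factor \<sigma> r1 r2 \<rho>1 \<rho>2 (x s))"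
    if generic: "gamma_generic N r1 r2 \<rho>1 \<rho>2"
  proof -
    define S where "S c y = c * sin (2 * pi * y)" for c y :: real
    have S: "odd_one_periodic (S c)" for c
      by (simp add: odd_one_periodic_def S_def distrib_left sin_add)
    have gS: "gamma_factor (S c) r1 r2 \<rho>1 \<rho>2 y = c * gamma_factor (S 1) r1 r2 \<rho>1 \<rho>2 y" for c y
      by (simp add: gamma_factor_def S_def)
    have poles: "{\<rho>1 - y, \<rho>1 + 1 + y, \<rho>2 - y, 1 + \<rho>2 + y,
         r2 + 1/2 + y, r2 + 1/2 - y, r1 + 1/2 + y, r1 + 1/2 - y} \<inter> \<int>\<^sub>\<le>\<^sub>0 = {}"
      if "s \<le> N" "y = x s" for s y
      using generic that by (simp add: gamma_generic_def Let_def x)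
    \<comment> \<open>An odd 1-periodic function vanishes at half-integers; genericity keeps \<open>x\<^sub>0\<close> away from them.\<close>
    have "sin (2 * pi * x 0) \<noteq> 0"
    proof
      assume "sin (2 * pi * x 0) = 0"
      then have "sin ((2 * x 0) * pi) = 0"
        by (simp add: mult_ac)
      then have "2 * x 0 \<in> \<int>"
        by (simp only: sin_times_pi_eq_0)
      then obtain i :: int where i: "2 * x 0 = of_int i"
        by (elim Ints_cases)
      moreover have "2 * x 0 = - (\<zeta> + \<eta>)"
        unfolding x grid_0 assms(8) by (simp add: field_simps)
      ultimately have "i < 0"
        using assms(4,5) by linarith
      have "r1 + 1/2 + x 0 = of_int (i + 1)"
        using i by (simp add: x grid_0)
      moreover have "(of_int (i + 1) :: real) \<in> \<int>\<^sub>\<le>\<^sub>0"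
        using \<open>i < 0\<close> by (simp only: of_int_in_nonpos_Ints_iff)
      ultimately show False
        using poles[of 0 "x 0"] by auto
    qed
    then have "gamma_factor (S 1) r1 r2 \<rho>1 \<rho>2 (x 0) \<noteq> 0"
      using poles[of 0 "x 0"] by (auto simp: gamma_factor_def S_def Gamma_eq_zero_iff)
    define c where "c = 1 / gamma_factor (S 1) r1 r2 \<rho>1 \<rho>2 (x 0)"
    have c: "gamma_factor (S c) r1 r2 \<rho>1 \<rho>2 (x 0) = 1"
      unfolding gS[of c] using \<open>gamma_factor (S 1) r1 r2 \<rho>1 \<rho>2 (x 0) \<noteq> 0\<close> by (simp add: c_def)
    have "x s \<in> gamma_factor_domain \<rho>1 \<rho>2" if "s \<le> N" for s
      using poles[OF that refl] by (auto simp: gamma_factor_domain_def)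
    then have "w s = gamma_factor (S c) r1 r2 \<rho>1 \<rho>2 (x s)" if "s \<le> N" for s
      using D.symmetry_factor_eq_weight[OF gamma_factor_symmetry[OF S[of c]] _ that] c
      by (simp add: w_def x)
    then show ?thesis
      using S by blast
  qed
  have weights: "\<exists>w \<kappa> :: nat \<Rightarrow> real.
      (\<forall>s\<le>N. w s > 0) \<and> (\<forall>n\<le>N. \<kappa> n \<noteq> 0) \<and>
      (\<forall>n\<le>N. \<forall>m\<le>N. (\<Sum>s = 0..N. w s * poly (P n) (x s) * poly (P m) (x s))
         = (if n = m then (\<kappa> n)\<^sup>2 else 0)) \<and>
      (\<exists>\<phi>. symmetry_factor_on UNIV r1 r2 \<rho>1 \<rho>2 \<phi> \<and> (\<forall>s\<le>N. w s = \<phi> (x s))) \<and>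
      (gamma_generic N r1 r2 \<rho>1 \<rho>2 \<longrightarrow>
         (\<exists>\<sigma>. odd_one_periodic \<sigma> \<and> (\<forall>s\<le>N. w s = gamma_factor \<sigma> r1 r2 \<rho>1 \<rho>2 (x s))))"
    by (intro exI[of _ w] exI[of _ \<kappa>] conjI impI w_pos \<kappa> orth phi gamma)

  have inj_x: "inj_on x {0..N}"
    unfolding x using D.inj_node by (rule inj_on_subset) simp
  have roots: "{t. poly (P (N + 1)) t = 0} = x ` {0..N}"
    using D.roots_P_Suc_N by (simp add: P x)
  have sigma: "\<forall>\<sigma>. odd_one_periodic \<sigma> \<longrightarrow>
      symmetry_factor_on (gamma_factor_domain \<rho>1 \<rho>2) r1 r2 \<rho>1 \<rho>2 (gamma_factor \<sigma> r1 r2 \<rho>1 \<rho>2) \<and>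
      (\<exists>c. \<forall>s\<le>N. \<sigma> (x s) = (- 1) ^ s * c)"
    unfolding x using gamma_factor_symmetry odd_one_periodic_grid by blast
  show ?thesis
    using r_sum inj recurrence inj_x roots sigma weights by (intro conjI)
qed

end
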